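(* Let $\lambda>0$ and $0\le\mu<1$, and assume: (1) there is $C_m>0$ such that for every $\theta\in\mathbb{R}^{N_p}$, $\mathbb{E}_{X\sim\pi_\theta}\big[\|\nabla_\theta\log|\psi_\theta(X)|\|^4\big]\le C_m$ and $\mathbb{E}_{X\sim\pi_\theta}\big[E_{\mathrm{loc}}(\theta;X)^4\big]\le C_m$; (2) there is $C_g>0$ such that $\|g(\theta)-g(\theta')\|\le C_g\|\theta-\theta'\|$ for all $\theta,\theta'\in\mathbb{R}^{N_p}$; (3) the step sizes satisfy $0<\eta_k\le\eta_{k-1}$ for all $k\ge1$, and $0<\eta_0\le \frac{2\lambda(1-\mu)}{C_g}$. Fix deterministic initial vectors $\theta_0,\Delta\theta_{-1}\in\mathbb{R}^{N_p}$. For a sample size $N_s\ge2$, let $\{\theta_k\}_{k\ge0}$ be generated by the SPRING iteration $$\Delta\theta_k=(\lambda I+S(\theta_k;\mathcal{B}_k))^{-1}\Big(\lambda\mu\,\Delta\theta_{k-1}-\tfrac12 g(\theta_k;\mathcal{B}_k)\Big),\qquad \theta_{k+1}=\theta_k+\eta_k\Delta\theta_k,\qquad k\ge 0,$$ where for each $k\ge0$ the batch $\mathcal{B}_k=\{X_{k,1},\dots,X_{k,N_s}\}$ consists, conditionally on all earlier batches, of i.i.d. samples from $\pi_{\theta_k}$. Then $$\min_{1\le k\le K}\mathbb{E}\big[\|g(\theta_k)\|^2\big]=\mathcal{O}\Big(\frac{1}{\sum_{k=1}^K\eta_k}\Big)+\mathcal{O}\Big(\frac1{N_s}\Big),$$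 i.e. there is a constant $C>0$, independent of $K$ and $N_s$, such that for all $K\ge1$ the left-hand side is at most $C\big(\frac{1}{\sum_{k=1}^K\eta_k}+\frac{1}{N_s}\big)$. Here $\mathbb{E}[\cdot]$ is the total expectation.
   Context: Variational Monte Carlo setting. $N$ is the number of particles, $\Omega$ the single-particle configuration space (continuous, or discrete, in which case integrals over $\Omega^N$ denote sums), and $\mathscr{H}$ is a self-adjoint Hamiltonian acting on functions on $\Omega^N$. $\{\psi_\theta\}_{\theta\in\mathbb{R}^{N_p}}$ is a parametrized family of nonzero square-integrable real-valued wavefunctions $\psi_\theta:\Omega^N\to\mathbb{R}$. Define: - $\pi_\theta(x)=|\psi_\theta(x)|^2/\int|\psi_\theta|^2$, a probability density (or mass function) on $\Omega^N$; - local energy $E_{\mathrm{loc}}(\theta;x)=(\mathscr{H}\psi_\theta)(x)/\psi_\theta(x)$; - energy $L(\theta)=\langle\psi_\theta|\mathscr{H}|\psi_\theta\rangle/\langle\psi_\theta|\psi_\theta\rangle=\mathbb{E}_{X\sim\pi_\theta}[E_{\mathrm{loc}}(\theta;X)]$; - $\bar E(\theta;x)=E_{\mathrm{loc}}(\theta;x)-L(\theta)$ and $O(\theta;x)=\nabla_\theta\log|\psi_\theta(x)|-\mathbb{E}_{X\sim\pi_\theta}[\nabla_\theta\log|\psi_\theta(X)|]\in\mathbb{R}^{N_p}$; - gradient $g(\theta)=\nabla_\theta L(\theta)$, for which the standard VMC identity $g(\theta)=2\,\mathbb{E}_{X\sim\pi_\theta}[\bar E(\theta;X)O(\theta;X)]$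 holds (standing assumption of the setting). Monte Carlo estimators for a batch $\mathcal{B}=\{X_1,\dots,X_{N_s}\}$, $N_s\ge2$: $L(\theta;\mathcal{B})=\frac1{N_s}\sum_i E_{\mathrm{loc}}(\theta;X_i)$, $\bar E(\theta;X_i,\mathcal{B})=E_{\mathrm{loc}}(\theta;X_i)-L(\theta;\mathcal{B})$, $O(\theta;X_i,\mathcal{B})=\nabla_\theta\log|\psi_\theta(X_i)|-\frac1{N_s}\sum_j\nabla_\theta\log|\psi_\theta(X_j)|$, $$g(\theta;\mathcal{B})=\frac{2}{N_s-1}\sum_{i=1}^{N_s}\bar E(\theta;X_i,\mathcal{B})\,O(\theta;X_i,\mathcal{B}),\qquad S(\theta;\mathcal{B})=\frac{1}{N_s-1}\sum_{i=1}^{N_s}O(\theta;X_i,\mathcal{B})\,O(\theta;X_i,\mathcal{B})^\top.$$ $\|\cdot\|$ is the Euclidean norm. In the algorithm of interest $\Delta\theta_{-1}=0$. *)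

theory Defs
  imports "HOL-Probability.Probability"
begin

section \<open>Configuration space and self-adjoint operators\<close>

text \<open>
  The base measure on the single-particle space \<open>\<Omega>\<close> is an arbitrary \<open>\<sigma>\<close>-finite measure:
  Lebesgue measure in the continuous case, counting measure in the discrete case (where all
  integrals below are sums).
\<close>

definition config_space :: "'a measure \<Rightarrow> nat \<Rightarrow> (nat \<Rightarrow> 'a) measure" where
  "config_space \<nu> N = Pi\<^sub>M {..<N} (\<lambda>_. \<nu>)"

definition square_integrable :: "'c measure \<Rightarrow> ('c \<Rightarrow> real) set" where
  "square_integrable Q = {f \<in> borel_measurable Q. integrable Q (\<lambda>x. (f x)\<^sup>2)}"

definition l2_inner :: "'c measure \<Rightarrow> ('c \<Rightarrow> real) \<Rightarrow> ('c \<Rightarrow> real) \<Rightarrow> real" where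
  "l2_inner Q f g = (\<integral>x. f x * g x \<partial>Q)"

definition densely_defined_linear ::
    "'c measure \<Rightarrow> ('c \<Rightarrow> real) set \<Rightarrow> (('c \<Rightarrow> real) \<Rightarrow> 'c \<Rightarrow> real) \<Rightarrow> bool" where
  "densely_defined_linear Q D H \<longleftrightarrow>
     D \<subseteq> square_integrable Q \<and> H ` D \<subseteq> square_integrable Q \<and> (\<lambda>x. 0) \<in> D \<and>
     (\<forall>f\<in>D. \<forall>g\<in>D. \<forall>a b. (\<lambda>x. a * f x + b * g x) \<in> D \<and>
        (AE x in Q. H (\<lambda>x. a * f x + b * g x) x = a * H f x + b * H g x)) \<and>
     (\<forall>f\<in>square_integrable Q. \<forall>\<epsilon>>0. \<exists>g\<in>D. (\<integral>x. (f x - g x)\<^sup>2 \<partial>Q) < \<epsilon>)"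

definition adjoint_graph ::
    "'c measure \<Rightarrow> ('c \<Rightarrow> real) set \<Rightarrow> (('c \<Rightarrow> real) \<Rightarrow> 'c \<Rightarrow> real) \<Rightarrow> (('c \<Rightarrow> real) \<times> ('c \<Rightarrow> real)) set" where
  "adjoint_graph Q D H = {(f, h). f \<in> square_integrable Q \<and> h \<in> square_integrable Q \<and>
     (\<forall>u\<in>D. l2_inner Q (H u) f = l2_inner Q u h)}"

text \<open>
  A possibly unbounded operator with domain \<open>D\<close> is self-adjoint if it is densely defined and
  its graph is that of its adjoint, so that the two domains agree. Elements of \<open>L\<^sup>2\<close> are
  represented by functions rather than by classes modulo null sets, whence the almost-everywhere
  equality; in particular \<open>D\<close> is closed under modification on null sets.
\<close>

definition self_adjoint_op ::
    "'c measure \<Rightarrow> ('c \<Rightarrow> real) set \<Rightarrow> (('c \<Rightarrow> real) \<Rightarrow> 'c \<Rightarrow> real) \<Rightarrow> bool" where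
  "self_adjoint_op Q D H \<longleftrightarrow>
     densely_defined_linear Q D H \<and>
     adjoint_graph Q D H =
       {(f, h). f \<in> D \<and> h \<in> square_integrable Q \<and> (AE x in Q. h x = H f x)}"


section \<open>Exact quantities\<close>

definition gradient :: "('v::real_inner \<Rightarrow> real) \<Rightarrow> 'v \<Rightarrow> 'v" where
  "gradient f t = (THE d. GDERIV f t :> d)"

definition born :: "'c measure \<Rightarrow> ('c \<Rightarrow> real) \<Rightarrow> 'c measure" where
  "born Q f = density Q (\<lambda>x. ennreal ((f x)\<^sup>2 / (\<integral>y. (f y)\<^sup>2 \<partial>Q)))"

definition local_energy ::
    "(('c \<Rightarrow> real) \<Rightarrow> 'c \<Rightarrow> real) \<Rightarrow> ('v \<Rightarrow> 'c \<Rightarrow> real) \<Rightarrow> 'v \<Rightarrow> 'c \<Rightarrow> real" where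
  "local_energy H \<psi> t x = H (\<psi> t) x / \<psi> t x"

definition energy ::
    "'c measure \<Rightarrow> (('c \<Rightarrow> real) \<Rightarrow> 'c \<Rightarrow> real) \<Rightarrow> ('v \<Rightarrow> 'c \<Rightarrow> real) \<Rightarrow> 'v \<Rightarrow> real" where
  "energy Q H \<psi> t = l2_inner Q (\<psi> t) (H (\<psi> t)) / l2_inner Q (\<psi> t) (\<psi> t)"

text \<open>
  The gradient of \<open>ln \<bar>\<psi>\<bar>\<close> is not defined at zeros of \<open>\<psi>\<close>; these form a null set for the Born
  distribution, and the value \<open>0\<close> chosen there is immaterial. The same applies to division
  by zero in \<open>local_energy\<close>.
\<close>

definition log_grad :: "('v::real_inner \<Rightarrow> 'c \<Rightarrow> real) \<Rightarrow> 'v \<Rightarrow> 'c \<Rightarrow> 'v" where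
  "log_grad \<psi> t x = (if \<psi> t x = 0 then 0 else gradient (\<lambda>s. ln \<bar>\<psi> s x\<bar>) t)"

definition centered_energy ::
    "'c measure \<Rightarrow> (('c \<Rightarrow> real) \<Rightarrow> 'c \<Rightarrow> real) \<Rightarrow> ('v \<Rightarrow> 'c \<Rightarrow> real) \<Rightarrow> 'v \<Rightarrow> 'c \<Rightarrow> real" where
  "centered_energy Q H \<psi> t x = local_energy H \<psi> t x - energy Q H \<psi> t"

definition centered_log_grad ::
    "'c measure \<Rightarrow> ('v::euclidean_space \<Rightarrow> 'c \<Rightarrow> real) \<Rightarrow> 'v \<Rightarrow> 'c \<Rightarrow> 'v" where
  "centered_log_grad Q \<psi> t x = log_grad \<psi> t x - (\<integral>y. log_grad \<psi> t y \<partial>born Q (\<psi> t))"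

definition energy_grad ::
    "'c measure \<Rightarrow> (('c \<Rightarrow> real) \<Rightarrow> 'c \<Rightarrow> real) \<Rightarrow> ('v::euclidean_space \<Rightarrow> 'c \<Rightarrow> real) \<Rightarrow> 'v \<Rightarrow> 'v" where
  "energy_grad Q H \<psi> t = gradient (energy Q H \<psi>) t"


section \<open>Monte Carlo estimators\<close>

text \<open>A batch of size \<open>n\<close> is a family \<open>b\<close> of configurations, of which \<open>b 0, \<dots>, b (n - 1)\<close> are used.\<close>

definition batch_energy ::
    "(('c \<Rightarrow> real) \<Rightarrow> 'c \<Rightarrow> real) \<Rightarrow> ('v \<Rightarrow> 'c \<Rightarrow> real) \<Rightarrow> nat \<Rightarrow> 'v \<Rightarrow> (nat \<Rightarrow> 'c) \<Rightarrow> real" where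
  "batch_energy H \<psi> n t b = (1 / real n) * (\<Sum>i<n. local_energy H \<psi> t (b i))"

definition batch_centered_energy ::
    "(('c \<Rightarrow> real) \<Rightarrow> 'c \<Rightarrow> real) \<Rightarrow> ('v \<Rightarrow> 'c \<Rightarrow> real) \<Rightarrow> nat \<Rightarrow> 'v \<Rightarrow> (nat \<Rightarrow> 'c) \<Rightarrow> nat \<Rightarrow> real" where
  "batch_centered_energy H \<psi> n t b i = local_energy H \<psi> t (b i) - batch_energy H \<psi> n t b"

definition batch_centered_log_grad ::
    "('v::euclidean_space \<Rightarrow> 'c \<Rightarrow> real) \<Rightarrow> nat \<Rightarrow> 'v \<Rightarrow> (nat \<Rightarrow> 'c) \<Rightarrow> nat \<Rightarrow> 'v" where
  "batch_centered_log_grad \<psi> n t b i =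
     log_grad \<psi> t (b i) - (1 / real n) *\<^sub>R (\<Sum>j<n. log_grad \<psi> t (b j))"

definition batch_grad ::
    "(('c \<Rightarrow> real) \<Rightarrow> 'c \<Rightarrow> real) \<Rightarrow> ('v::euclidean_space \<Rightarrow> 'c \<Rightarrow> real) \<Rightarrow> nat \<Rightarrow> 'v \<Rightarrow> (nat \<Rightarrow> 'c) \<Rightarrow> 'v" where
  "batch_grad H \<psi> n t b =
     (2 / (real n - 1)) *\<^sub>R
       (\<Sum>i<n. batch_centered_energy H \<psi> n t b i *\<^sub>R batch_centered_log_grad \<psi> n t b i)"

definition outer_product :: "real^'p \<Rightarrow> real^'p \<Rightarrow> real^'p^'p" where
  "outer_product u v = (\<chi> i j. u $ i * v $ j)"

definition batch_S ::
    "(real^'p \<Rightarrow> 'c \<Rightarrow> real) \<Rightarrow> nat \<Rightarrow> real^'p \<Rightarrow> (nat \<Rightarrow> 'c) \<Rightarrow> real^'p^'p" where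
  "batch_S \<psi> n t b =
     (1 / (real n - 1)) *\<^sub>R
       (\<Sum>i<n. outer_product (batch_centered_log_grad \<psi> n t b i) (batch_centered_log_grad \<psi> n t b i))"


section \<open>The SPRING iteration\<close>

definition batch :: "nat \<Rightarrow> (nat \<Rightarrow> nat \<Rightarrow> 'w \<Rightarrow> 'c) \<Rightarrow> nat \<Rightarrow> 'w \<Rightarrow> nat \<Rightarrow> 'c" where
  "batch n X k \<omega> = (\<lambda>i\<in>{..<n}. X k i \<omega>)"

definition past :: "'w measure \<Rightarrow> 'c measure \<Rightarrow> nat \<Rightarrow> (nat \<Rightarrow> nat \<Rightarrow> 'w \<Rightarrow> 'c) \<Rightarrow> nat \<Rightarrow> 'w measure" where
  "past P Q n X k =
     vimage_algebra (space P) (\<lambda>\<omega>. \<lambda>j\<in>{..<k}. batch n X j \<omega>)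
       (Pi\<^sub>M {..<k} (\<lambda>_. Pi\<^sub>M {..<n} (\<lambda>_. Q)))"

text \<open>
  The random vector \<open>\<theta> k\<close> is the iterate \<open>\<theta>\<^sub>k\<close>, while \<open>\<Delta>\<close> is shifted by one: \<open>\<Delta> k\<close> is the
  increment with index \<open>k - 1\<close>, so that \<open>\<Delta> 0\<close> is the deterministic initial increment. The last
  clause says that the conditional law of the \<open>k\<close>-th batch given all earlier ones is the
  \<open>n\<close>-fold product of the Born distribution at the current iterate.
\<close>

definition spring_run ::
    "'c measure \<Rightarrow> (('c \<Rightarrow> real) \<Rightarrow> 'c \<Rightarrow> real) \<Rightarrow> (real^'p \<Rightarrow> 'c \<Rightarrow> real) \<Rightarrow>
     real \<Rightarrow> real \<Rightarrow> (nat \<Rightarrow> real) \<Rightarrow> real^'p \<Rightarrow> real^'p \<Rightarrow> nat \<Rightarrow>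
     'w measure \<Rightarrow> (nat \<Rightarrow> nat \<Rightarrow> 'w \<Rightarrow> 'c) \<Rightarrow> (nat \<Rightarrow> 'w \<Rightarrow> real^'p) \<Rightarrow> (nat \<Rightarrow> 'w \<Rightarrow> real^'p) \<Rightarrow> bool" where
  "spring_run Q H \<psi> lam \<mu> \<eta> \<theta>init \<Delta>init n P X \<theta> \<Delta> \<longleftrightarrow>
     prob_space P \<and>
     (\<forall>k. \<forall>i<n. X k i \<in> measurable P Q) \<and>
     (\<forall>\<omega>\<in>space P. \<theta> 0 \<omega> = \<theta>init \<and> \<Delta> 0 \<omega> = \<Delta>init) \<and>
     (\<forall>k. \<forall>\<omega>\<in>space P.
        \<Delta> (Suc k) \<omega> =
          matrix_inv (lam *\<^sub>R mat 1 + batch_S \<psi> n (\<theta> k \<omega>) (batch n X k \<omega>)) *v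
            ((lam * \<mu>) *\<^sub>R \<Delta> k \<omega> - (1/2) *\<^sub>R batch_grad H \<psi> n (\<theta> k \<omega>) (batch n X k \<omega>)) \<and>
        \<theta> (Suc k) \<omega> = \<theta> k \<omega> + \<eta> k *\<^sub>R \<Delta> (Suc k) \<omega>) \<and>
     (\<forall>k. \<forall>A\<in>sets (Pi\<^sub>M {..<n} (\<lambda>_. Q)). AE \<omega> in P.
        real_cond_exp P (past P Q n X k) (indicat_real {\<omega> \<in> space P. batch n X k \<omega> \<in> A}) \<omega> =
          measure (Pi\<^sub>M {..<n} (\<lambda>_. born Q (\<psi> (\<theta> k \<omega>)))) A)"

end

theory Submission
  imports Defs
begin

text \<open>
  The iteration says \<open>g(\<theta>\<^sub>k;B\<^sub>k) = 2 (\<lambda>\<mu> \<Delta>\<theta>\<^bsub>k-1\<^esub> - (\<lambda>I + S(\<theta>\<^sub>k;B\<^sub>k)) \<Delta>\<theta>\<^sub>k)\<close>. Inserting this into the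
  descent inequality for \<open>L\<close> shows that \<open>L(\<theta>\<^sub>k) + \<lambda>\<mu>\<eta>\<^sub>k \<parallel>\<Delta>\<theta>\<^bsub>k-1\<^esub>\<parallel>\<^sup>2\<close> decreases by a multiple of
  \<open>\<eta>\<^sub>k \<parallel>\<Delta>\<theta>\<^sub>k\<parallel>\<^sup>2\<close>, up to a multiple of \<open>\<eta>\<^sub>k\<close> times the squared error of the gradient estimator; so
  \<open>\<Sum> \<eta>\<^sub>k \<parallel>\<Delta>\<theta>\<^sub>k\<parallel>\<^sup>2\<close> is controlled on every path. The same identity, paired with the bounded
  vector \<open>g(\<theta>\<^sub>k)\<close>, bounds \<open>\<parallel>g(\<theta>\<^sub>k)\<parallel>\<^sup>2\<close> by \<open>\<parallel>\<Delta>\<theta>\<^bsub>k-1\<^esub>\<parallel>\<^sup>2 + \<parallel>\<Delta>\<theta>\<^sub>k\<parallel>\<^sup>2\<close> and the squared errors of the two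
  estimators. These are errors of sample covariances of variables with bounded fourth moments,
  hence of conditional expectation \<open>O(1/N\<^sub>s)\<close> given the past. No unbiasedness of the
  preconditioned direction is needed.
\<close>

section \<open>Mean square error of the sample covariance\<close>

text \<open>The obstacle is that each increment is built from the same batch as both estimators, so
  the preconditioned direction has no tractable conditional mean. Hence all inequalities are proved
  pathwise, and conditioning is applied only to the squared estimator errors, which depend on the
  current iterate and its batch alone. Three facts used on the path come from the moment hypotheses:
  the energy is bounded below, being a mean of the local energy; its gradient is bounded, since the
  VMC identity makes it a covariance; and the covariance matrix estimated by \<open>batch_S\<close>
  is bounded, whereas \<open>batch_S\<close> itself has no bound uniform in the batch. Conditioning
  has its own difficulty: the conditional law is given event by event, each event with its own null
  set, while the error depends jointly on a random parameter and the batch. The Born laws have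
  jointly measurable densities over one fixed product measure, which allows the joint law of iterate
  and batch to be identified.\<close>

lemma (in prob_space) integrable_lower_power:
  fixes X :: "'a \<Rightarrow> real"
  assumes [measurable]: "X \<in> borel_measurable M" and X4: "integrable M (\<lambda>w. X w ^ 4)" and "k \<le> 4"
  shows "integrable M (\<lambda>w. X w ^ k)"
proof (rule Bochner_Integration.integrable_bound)
  show "integrable M (\<lambda>w. 1 + X w ^ 4)"
    using X4 by simp
  have "\<bar>x\<bar> ^ k \<le> 1 + x ^ 4" for x :: real
  proof (cases "\<bar>x\<bar> \<le> 1")
    case True
    have "\<bar>x\<bar> ^ k \<le> 1"
      by (rule power_le_one) (use True in auto)
    moreover have "0 \<le> x ^ 4"
      by simp
    ultimately show ?thesis by linarith
  next
    case False
    have "\<bar>x\<bar> ^ k \<le> \<bar>x\<bar> ^ 4"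
      by (rule power_increasing) (use False \<open>k \<le> 4\<close> in auto)
    then show ?thesis by simp
  qed
  then have "norm (X w ^ k) \<le> norm (1 + X w ^ 4)" for w
    by (simp add: power_abs abs_of_nonneg)
  then show "AE w in M. norm (X w ^ k) \<le> norm (1 + X w ^ 4)"
    by simp
qed simp

text \<open>Induction on the number of summands: the new centred summand is independent of the
  partial sum, so the cross term has expectation zero.\<close>

lemma (in prob_space) second_moment_indep_sum:
  fixes X :: "nat \<Rightarrow> 'a \<Rightarrow> real"
  assumes indep: "indep_vars (\<lambda>_. borel) X {..<n}"
    and X2: "\<And>i. i < n \<Longrightarrow> integrable M (\<lambda>w. (X i w)\<^sup>2)"
    and EX: "\<And>i. i < n \<Longrightarrow> expectation (X i) = 0"
    and EX2: "\<And>i. i < n \<Longrightarrow> expectation (\<lambda>w. (X i w)\<^sup>2) \<le> s"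
  shows "integrable M (\<lambda>w. (\<Sum>i<n. X i w)\<^sup>2)"
    and "expectation (\<lambda>w. \<Sum>i<n. X i w) = 0"
    and "expectation (\<lambda>w. (\<Sum>i<n. X i w)\<^sup>2) \<le> real n * s"
proof -
  let ?T = "\<lambda>m w. \<Sum>i<m. X i w"
  have meas: "X i \<in> borel_measurable M" if "i < n" for i
    using indep that unfolding indep_vars_def2 by auto
  have "m \<le> n \<Longrightarrow> integrable M (\<lambda>w. (?T m w)\<^sup>2) \<and> expectation (?T m) = 0 \<and>
     expectation (\<lambda>w. (?T m w)\<^sup>2) \<le> real m * s" for m
  proof (induction m)
    case (Suc m)
    then have m: "m < n" by simp
    note IH = Suc.IH[OF less_imp_le[OF m]]
    have [measurable]: "X m \<in> borel_measurable M"
      using meas m by simp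
    have [measurable]: "?T m \<in> borel_measurable M"
      using meas m by (intro borel_measurable_sum) auto
    have "indep_vars (\<lambda>_. borel) X (insert m {..<m})"
      using m by (intro indep_vars_subset[OF indep]) auto
    from indep_vars_sum[OF _ _ this]
    have XT: "indep_var borel (X m) borel (?T m)"
      by simp
    have iX: "integrable M (X m)"
      by (rule square_integrable_imp_integrable) (use X2[OF m] in auto)
    have iT: "integrable M (?T m)"
      by (rule square_integrable_imp_integrable) (use IH in auto)
    have iXT: "integrable M (\<lambda>w. X m w * ?T m w)"
      by (rule indep_var_integrable[OF XT iX iT])
    have eXT: "expectation (\<lambda>w. X m w * ?T m w) = 0"
      using indep_var_lebesgue_integral[OF XT iX iT] EX[OF m] by simp
    have T2: "(?T (Suc m) w)\<^sup>2 = (?T m w)\<^sup>2 + 2 * (X m w * ?T m w) + (X m w)\<^sup>2" for w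
      by (simp add: power2_eq_square algebra_simps)
    have 1: "expectation (?T (Suc m)) = 0"
      using IH EX[OF m] iX iT by simp
    have "expectation (\<lambda>w. (?T (Suc m) w)\<^sup>2) = expectation (\<lambda>w. (?T m w)\<^sup>2) + expectation (\<lambda>w. (X m w)\<^sup>2)"
      unfolding T2 using X2[OF m] IH iXT eXT by simp
    then have 2: "expectation (\<lambda>w. (?T (Suc m) w)\<^sup>2) \<le> real (Suc m) * s"
      using IH EX2[OF m] by (simp add: algebra_simps)
    have "integrable M (\<lambda>w. (?T (Suc m) w)\<^sup>2)"
      unfolding T2 using X2[OF m] IH iXT by simp
    with 1 2 show ?case by simp
  qed simp
  from this[of n] show "integrable M (\<lambda>w. (\<Sum>i<n. X i w)\<^sup>2)"
    and "expectation (\<lambda>w. \<Sum>i<n. X i w) = 0"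
    and "expectation (\<lambda>w. (\<Sum>i<n. X i w)\<^sup>2) \<le> real n * s"
    by auto
qed

text \<open>The growth is quadratic rather than quartic in \<open>n\<close> because, in the
  expansion of the fourth power of partial sum plus new summand, both odd terms vanish by
  independence and centring. The mixed even term contributes at most \<open>6 * m * s^2\<close>,
  hence at most \<open>6 * m * q\<close>, and \<open>3 * m^2 + 6 * m + 1\<close> is below
  \<open>3 * (m + 1)^2\<close>.\<close>

lemma (in prob_space) fourth_moment_indep_sum:
  fixes X :: "nat \<Rightarrow> 'a \<Rightarrow> real"
  assumes indep: "indep_vars (\<lambda>_. borel) X {..<n}"
    and X4: "\<And>i. i < n \<Longrightarrow> integrable M (\<lambda>w. X i w ^ 4)"
    and EX: "\<And>i. i < n \<Longrightarrow> expectation (X i) = 0"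
    and EX2: "\<And>i. i < n \<Longrightarrow> expectation (\<lambda>w. (X i w)\<^sup>2) \<le> s"
    and EX4: "\<And>i. i < n \<Longrightarrow> expectation (\<lambda>w. X i w ^ 4) \<le> q"
    and s: "0 \<le> s" "s\<^sup>2 \<le> q"
  shows "integrable M (\<lambda>w. (\<Sum>i<n. X i w) ^ 4)"
    and "expectation (\<lambda>w. (\<Sum>i<n. X i w) ^ 4) \<le> 3 * (real n)\<^sup>2 * q"
proof -
  let ?T = "\<lambda>m w. \<Sum>i<m. X i w"
  have q: "0 \<le> q"
    using order_trans[OF zero_le_power2 s(2)] .
  have meas: "X i \<in> borel_measurable M" if "i < n" for i
    using indep that unfolding indep_vars_def2 by auto
  have X2: "integrable M (\<lambda>w. (X i w)\<^sup>2)" if "i < n" for i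
    by (rule integrable_lower_power) (use meas X4 that in auto)
  have "m \<le> n \<Longrightarrow> integrable M (\<lambda>w. ?T m w ^ 4) \<and>
     expectation (\<lambda>w. ?T m w ^ 4) \<le> 3 * (real m)\<^sup>2 * q" for m
  proof (induction m)
    case (Suc m)
    then have m: "m < n" by simp
    note IH = Suc.IH[OF less_imp_le[OF m]]
    have [measurable]: "X m \<in> borel_measurable M"
      using meas m by simp
    have [measurable]: "?T m \<in> borel_measurable M"
      using meas m by (intro borel_measurable_sum) auto
    have "indep_vars (\<lambda>_. borel) X (insert m {..<m})"
      using m by (intro indep_vars_subset[OF indep]) auto
    from indep_vars_sum[OF _ _ this]
    have XT: "indep_var borel (X m) borel (?T m)"
      by simp
    have "indep_var borel ((\<lambda>x. x ^ j) \<circ> X m) borel ((\<lambda>x. x ^ k) \<circ> ?T m)" for j k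
      by (rule indep_var_compose[OF XT]) auto
    then have ind: "indep_var borel (\<lambda>w. X m w ^ j) borel (\<lambda>w. ?T m w ^ k)" for j k
      by (simp add: comp_def)
    have iX: "integrable M (\<lambda>w. X m w ^ k)" if "k \<le> 4" for k
      by (rule integrable_lower_power) (use that X4[OF m] in auto)
    have iT: "integrable M (\<lambda>w. ?T m w ^ k)" if "k \<le> 4" for k
      by (rule integrable_lower_power) (use that IH in auto)
    have iXT: "integrable M (\<lambda>w. X m w ^ j * ?T m w ^ k)" if "j \<le> 4" "k \<le> 4" for j k
      using that by (intro indep_var_integrable ind iX iT)
    have eXT: "expectation (\<lambda>w. X m w ^ j * ?T m w ^ k)
        = expectation (\<lambda>w. X m w ^ j) * expectation (\<lambda>w. ?T m w ^ k)" if "j \<le> 4" "k \<le> 4" for j k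
      using that by (intro indep_var_lebesgue_integral ind iX iT)
    have indm: "indep_vars (\<lambda>_. borel) X {..<m}"
      using m by (intro indep_vars_subset[OF indep]) auto
    have T2: "expectation (\<lambda>w. ?T m w ^ 2) \<le> real m * s"
      using m by (intro second_moment_indep_sum(3)[OF indm] EX EX2 X2) auto
    have expT: "expectation (?T m) = 0"
      using m by (intro second_moment_indep_sum(2)[OF indm, where s=s] EX EX2 X2) auto
    have T4: "?T (Suc m) w ^ 4 = ?T m w ^ 4 + 4 * (X m w ^ 1 * ?T m w ^ 3) + 6 * (X m w ^ 2 * ?T m w ^ 2)
        + 4 * (X m w ^ 3 * ?T m w ^ 1) + X m w ^ 4" for w
      unfolding sum.lessThan_Suc by (simp add: eval_nat_numeral algebra_simps)
    have 3: "integrable M (\<lambda>w. ?T (Suc m) w ^ 4)"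
      unfolding T4 by (intro Bochner_Integration.integrable_add integrable_mult_right iX iT iXT) auto
    have "expectation (\<lambda>w. ?T (Suc m) w ^ 4) = expectation (\<lambda>w. ?T m w ^ 4)
        + 6 * (expectation (\<lambda>w. X m w ^ 2) * expectation (\<lambda>w. ?T m w ^ 2)) + expectation (\<lambda>w. X m w ^ 4)"
      unfolding T4 using iX[of 4] iT[of 4] iXT[of 1 3] iXT[of 2 2] iXT[of 3 1]
        eXT[of 1 3] eXT[of 2 2] eXT[of 3 1] EX[OF m] expT by simp
    also have "\<dots> \<le> 3 * (real m)\<^sup>2 * q + 6 * (s * (real m * s)) + q"
      using IH T2 EX2[OF m] EX4[OF m] s by (intro add_mono mult_left_mono mult_mono) auto
    also have "\<dots> \<le> 3 * (real m)\<^sup>2 * q + 6 * (real m * q) + q"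
      using mult_left_mono[OF s(2), of "real m"] by (simp add: power2_eq_square mult_ac)
    also have "\<dots> \<le> 3 * (real (Suc m))\<^sup>2 * q"
      using q by (simp add: power2_eq_square algebra_simps)
    finally show ?case using 3 by simp
  qed simp
  from this[of n] show "integrable M (\<lambda>w. (\<Sum>i<n. X i w) ^ 4)"
    and "expectation (\<lambda>w. (\<Sum>i<n. X i w) ^ 4) \<le> 3 * (real n)\<^sup>2 * q"
    by auto
qed

text \<open>Independence means that the joint law is the product of the marginals, and on the
  product space the tuple of all coordinates is the identity map.\<close>

lemma indep_vars_PiM_coordinates:
  assumes "\<And>i. prob_space (M i)" and "I \<noteq> {}"
  shows "prob_space.indep_vars (PiM I M) M (\<lambda>i x. x i) I"
proof -
  interpret product_prob_space M I
    using assms(1) by (simp add: product_prob_spaceI)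
  have "distr (PiM I M) (M i) (\<lambda>x. x i) = M i" if "i \<in> I" for i
    using that by (rule PiM_component)
  moreover have "distr (PiM I M) (PiM I M) (\<lambda>x. \<lambda>i\<in>I. x i) = distr (PiM I M) (PiM I M) (\<lambda>x. x)"
    by (intro distr_cong) (auto simp: space_PiM PiE_restrict)
  ultimately show ?thesis
    using assms(2) by (subst indep_vars_iff_distr_eq_PiM')
       (auto intro!: PiM_cong simp: distr_id)
qed

text \<open>Jensen's inequality for the square, read off from a nonnegative variance: once for the
  square of \<open>f\<close> and once for \<open>f\<close> itself.\<close>

lemma (in prob_space) power_four_expectation_le:
  fixes f :: "'a \<Rightarrow> real"
  assumes [measurable]: "f \<in> borel_measurable M" and f4: "integrable M (\<lambda>x. f x ^ 4)"
  shows "(expectation (\<lambda>x. (f x)\<^sup>2))\<^sup>2 \<le> expectation (\<lambda>x. f x ^ 4)"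
    and "expectation f ^ 4 \<le> expectation (\<lambda>x. f x ^ 4)"
proof -
  have i: "integrable M (\<lambda>x. f x ^ k)" if "k \<le> 4" for k
    by (rule integrable_lower_power) (use that f4 in auto)
  have "0 \<le> variance (\<lambda>x. (f x)\<^sup>2)" by (rule variance_positive)
  then show *: "(expectation (\<lambda>x. (f x)\<^sup>2))\<^sup>2 \<le> expectation (\<lambda>x. f x ^ 4)"
    using i[of 2] f4 by (subst (asm) variance_eq) auto
  have "0 \<le> variance f" by (rule variance_positive)
  then have "(expectation f)\<^sup>2 \<le> expectation (\<lambda>x. (f x)\<^sup>2)"
    using i[of 1] i[of 2] by (subst (asm) variance_eq) auto
  then have "((expectation f)\<^sup>2)\<^sup>2 \<le> (expectation (\<lambda>x. (f x)\<^sup>2))\<^sup>2"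
    by (rule power_mono) simp
  with * show "expectation f ^ 4 \<le> expectation (\<lambda>x. f x ^ 4)"
    by simp
qed

text \<open>The factor 16 is 8 + 8: \<open>(x - y)^4 \<le> 8 * x^4 + 8 * y^4\<close>, and the fourth
  power of the mean is at most the fourth moment.\<close>

lemma (in prob_space) centered_fourth_moment:
  fixes f :: "'a \<Rightarrow> real"
  assumes [measurable]: "f \<in> borel_measurable M" and f4: "integrable M (\<lambda>x. f x ^ 4)"
    and C: "expectation (\<lambda>x. f x ^ 4) \<le> C"
  defines "g \<equiv> \<lambda>x. f x - expectation f"
  shows "integrable M (\<lambda>x. g x ^ 4)" and "expectation (\<lambda>x. g x ^ 4) \<le> 16 * C"
    and "expectation g = 0"
proof -
  have bound: "(x - y) ^ 4 \<le> 8 * x ^ 4 + 8 * y ^ 4" for x y :: real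
  proof -
    have "(x - y)\<^sup>2 \<le> 2 * x\<^sup>2 + 2 * y\<^sup>2"
      using zero_le_power2[of "x + y"] by (simp add: power2_eq_square algebra_simps)
    then have "((x - y)\<^sup>2)\<^sup>2 \<le> (2 * x\<^sup>2 + 2 * y\<^sup>2)\<^sup>2"
      by (rule power_mono) simp
    also have "\<dots> \<le> 8 * (x\<^sup>2)\<^sup>2 + 8 * (y\<^sup>2)\<^sup>2"
      using zero_le_power2[of "x\<^sup>2 - y\<^sup>2"] by (simp add: power2_eq_square algebra_simps)
    finally show ?thesis by simp
  qed
  have i: "integrable M f"
    using integrable_lower_power[OF assms(1) f4, of 1] by simp
  have ib: "integrable M (\<lambda>x. 8 * f x ^ 4 + 8 * expectation f ^ 4)"
    using f4 by simp
  show g4: "integrable M (\<lambda>x. g x ^ 4)"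
    by (rule Bochner_Integration.integrable_bound[OF ib])
       (use bound in \<open>auto simp: g_def\<close>)
  have "expectation (\<lambda>x. g x ^ 4) \<le> expectation (\<lambda>x. 8 * f x ^ 4 + 8 * expectation f ^ 4)"
    by (rule integral_mono[OF g4 ib]) (use bound in \<open>auto simp: g_def\<close>)
  also have "\<dots> = 8 * expectation (\<lambda>x. f x ^ 4) + 8 * expectation f ^ 4"
    using f4 by (simp add: prob_space)
  also have "\<dots> \<le> 16 * C"
    using power_four_expectation_le(2)[OF assms(1) f4] C by simp
  finally show "expectation (\<lambda>x. g x ^ 4) \<le> 16 * C" .
  show "expectation g = 0"
    using i by (simp add: g_def prob_space)
qed

lemma fourth_moment_le:
  fixes f :: "'c \<Rightarrow> real"
  assumes [measurable]: "f \<in> borel_measurable M"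
    and le: "(\<integral>\<^sup>+ x. ennreal (f x ^ 4) \<partial>M) \<le> ennreal C" and "0 \<le> C"
  shows "integrable M (\<lambda>x. f x ^ 4)" and "(\<integral>x. f x ^ 4 \<partial>M) \<le> C"
proof -
  show i: "integrable M (\<lambda>x. f x ^ 4)"
    using le by (intro integrableI_bounded) (auto simp: top.not_eq_extremum[symmetric] top_unique)
  show "(\<integral>x. f x ^ 4 \<partial>M) \<le> C"
    using le \<open>0 \<le> C\<close> by (subst (asm) nn_integral_eq_integral[OF i]) (auto simp: ennreal_le_iff)
qed

lemma (in prob_space) integrable_mult_fourth:
  fixes f g :: "'a \<Rightarrow> real"
  assumes [measurable]: "f \<in> borel_measurable M" "g \<in> borel_measurable M"
    and fg: "integrable M (\<lambda>x. f x ^ 4)" "integrable M (\<lambda>x. g x ^ 4)"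
  shows "integrable M (\<lambda>x. (f x * g x)\<^sup>2)" and "integrable M (\<lambda>x. f x * g x)"
    and "expectation (\<lambda>x. (f x * g x)\<^sup>2) \<le> (expectation (\<lambda>x. f x ^ 4) + expectation (\<lambda>x. g x ^ 4)) / 2"
proof -
  have le: "(f x * g x)\<^sup>2 \<le> (f x ^ 4 + g x ^ 4) / 2" for x
    using zero_le_power2[of "(f x)\<^sup>2 - (g x)\<^sup>2"] by (simp add: eval_nat_numeral algebra_simps)
  have ib: "integrable M (\<lambda>x. (f x ^ 4 + g x ^ 4) / 2)"
    using fg by simp
  show i2: "integrable M (\<lambda>x. (f x * g x)\<^sup>2)"
    by (rule Bochner_Integration.integrable_bound[OF ib]) (use le in auto)
  show "integrable M (\<lambda>x. f x * g x)"
    by (rule square_integrable_imp_integrable[OF _ i2]) simp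
  have "expectation (\<lambda>x. (f x * g x)\<^sup>2) \<le> expectation (\<lambda>x. (f x ^ 4 + g x ^ 4) / 2)"
    by (rule integral_mono[OF i2 ib le])
  then show "expectation (\<lambda>x. (f x * g x)\<^sup>2) \<le> (expectation (\<lambda>x. f x ^ 4) + expectation (\<lambda>x. g x ^ 4)) / 2"
    using fg by simp
qed

text \<open>Up to a factor 2 the entries of the energy gradient are of this form, and so are the
  entries of the matrix estimated by \<open>batch_S\<close>. One scalar error bound for
  \<open>sample_cov\<close> therefore serves both estimators.\<close>

definition covariance :: "'c measure \<Rightarrow> ('c \<Rightarrow> real) \<Rightarrow> ('c \<Rightarrow> real) \<Rightarrow> real" where
  "covariance M a b = (\<integral>x. (a x - integral\<^sup>L M a) * (b x - integral\<^sup>L M b) \<partial>M)"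

definition sample_cov :: "nat \<Rightarrow> (nat \<Rightarrow> real) \<Rightarrow> (nat \<Rightarrow> real) \<Rightarrow> real" where
  "sample_cov n u v = (1 / (real n - 1)) *
     (\<Sum>i<n. (u i - (1 / real n) * (\<Sum>j<n. u j)) * (v i - (1 / real n) * (\<Sum>j<n. v j)))"

text \<open>Allows the samples to be centred at their true means, so that the sums in the error
  formula have mean zero.\<close>

lemma sample_cov_shift:
  assumes "n > 0"
  shows "sample_cov n (\<lambda>i. u i - c) (\<lambda>i. v i - d) = sample_cov n u v"
  using assms unfolding sample_cov_def by (simp add: sum_subtractf algebra_simps)

lemma sample_cov_eq:
  assumes "n > 0"
  shows "sample_cov n u v = (1 / (real n - 1)) * ((\<Sum>i<n. u i * v i) - (\<Sum>i<n. u i) * (\<Sum>i<n. v i) / real n)"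
proof -
  have "(\<Sum>i<n. (u i - a) * (v i - b)) = (\<Sum>i<n. u i * v i) - a * (\<Sum>i<n. v i) - b * (\<Sum>i<n. u i) + real n * (a * b)" for a b
    by (simp add: algebra_simps sum.distrib sum_subtractf sum_distrib_left sum_distrib_right)
  from this[of "(1 / real n) * (\<Sum>j<n. u j)" "(1 / real n) * (\<Sum>j<n. v j)"] show ?thesis
    unfolding sample_cov_def using assms by (auto simp: mult_ac)
qed

text \<open>With \<open>p\<close>, \<open>a\<close>, \<open>b\<close> as in the proof, the error
  equals \<open>r * (p - a * b + c / n)\<close>, where \<open>r = n / (n - 1)\<close> is at most 2.
  The term \<open>c / n\<close> offsets the expectation of \<open>a * b\<close> for centred i.i.d.
  pairs of covariance \<open>c\<close>; it is estimated separately, since only the order in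
  \<open>n\<close> matters. The factor 12 is 4 from the square of \<open>r\<close> times 3 from
  squaring three terms.\<close>

lemma sample_cov_error_le:
  assumes n: "n \<ge> 2"
  shows "(sample_cov n u v - c)\<^sup>2 \<le> 12 * ((\<Sum>i<n. u i * v i - c)\<^sup>2 / (real n)\<^sup>2
     + ((\<Sum>i<n. u i) ^ 4 + (\<Sum>i<n. v i) ^ 4) / (2 * (real n) ^ 4) + c\<^sup>2 / (real n)\<^sup>2)"
proof -
  define r where "r = real n / (real n - 1)"
  define p where "p = (\<Sum>i<n. u i * v i - c) / real n"
  define a b where "a = (\<Sum>i<n. u i) / real n" and "b = (\<Sum>i<n. v i) / real n"
  have r: "0 \<le> r" "r \<le> 2"
    using n by (auto simp: r_def field_simps)
  have "sample_cov n u v - c = r * (p - a * b + c / real n)"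
    using n unfolding r_def p_def a_def b_def
    by (subst sample_cov_eq) (auto simp: field_simps sum_subtractf)
  then have "(sample_cov n u v - c)\<^sup>2 = r\<^sup>2 * (p - a * b + c / real n)\<^sup>2"
    by (simp add: power_mult_distrib)
  also have "\<dots> \<le> 4 * (p - a * b + c / real n)\<^sup>2"
    using power_mono[OF r(2,1), of 2] by (intro mult_right_mono) auto
  also have "(p - a * b + c / real n)\<^sup>2 \<le> 3 * (p\<^sup>2 + (a * b)\<^sup>2 + (c / real n)\<^sup>2)"
  proof -
    have "(x - y + z)\<^sup>2 \<le> 3 * (x\<^sup>2 + y\<^sup>2 + z\<^sup>2)" for x y z :: real
      using zero_le_power2[of "x + y"] zero_le_power2[of "x - z"] zero_le_power2[of "y + z"]
      by (simp add: power2_eq_square algebra_simps)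
    then show ?thesis .
  qed
  also have "(a * b)\<^sup>2 \<le> (a ^ 4 + b ^ 4) / 2"
    using zero_le_power2[of "a\<^sup>2 - b\<^sup>2"] by (simp add: eval_nat_numeral algebra_simps)
  finally show ?thesis
    by (simp add: p_def a_def b_def power_divide add_divide_distrib)
qed

text \<open>After centring, fourth moments are at most \<open>16 * C\<close>. The sum of centred
  products contributes \<open>16 * C / n\<close>, the fourth powers of the two sample sums
  \<open>48 * C / n^2\<close>, and the remainder \<open>16 * C / n^2\<close>; with the outer factor
  12 this gives 12 * (16 + 64) = 960. The bound on the square of \<open>c\<close> later yields the
  deterministic bounds on the energy gradient and on \<open>mean_S\<close>.\<close>

lemma sample_cov_mse:
  fixes a b :: "'c \<Rightarrow> real"
  assumes "prob_space M" and [measurable]: "a \<in> borel_measurable M" "b \<in> borel_measurable M"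
    and n: "n \<ge> 2"
    and a4: "(\<integral>\<^sup>+ x. ennreal (a x ^ 4) \<partial>M) \<le> ennreal C"
    and b4: "(\<integral>\<^sup>+ x. ennreal (b x ^ 4) \<partial>M) \<le> ennreal C" and C: "0 \<le> C"
  defines "c \<equiv> covariance M a b"
  shows "(\<integral>\<^sup>+ x. ennreal ((sample_cov n (\<lambda>i. a (x i)) (\<lambda>i. b (x i)) - c)\<^sup>2) \<partial>(\<Pi>\<^sub>M i\<in>{..<n}. M))
      \<le> ennreal (960 * C / real n)"
    and "c\<^sup>2 \<le> 16 * C"
proof -
  interpret prob_space M by fact
  interpret P: prob_space "\<Pi>\<^sub>M i\<in>{..<n}. M"
    by (rule prob_space_PiM) (rule assms(1))
  define f g where "f = (\<lambda>x. a x - expectation a)" and "g = (\<lambda>x. b x - expectation b)"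
  have [measurable]: "f \<in> borel_measurable M" "g \<in> borel_measurable M"
    unfolding f_def g_def by measurable
  note fa = fourth_moment_le[OF assms(2) a4 C] and fb = fourth_moment_le[OF assms(3) b4 C]
  have f: "integrable M (\<lambda>x. f x ^ 4)" "expectation (\<lambda>x. f x ^ 4) \<le> 16 * C" "expectation f = 0"
    using centered_fourth_moment[OF assms(2) fa] by (auto simp: f_def)
  have g: "integrable M (\<lambda>x. g x ^ 4)" "expectation (\<lambda>x. g x ^ 4) \<le> 16 * C" "expectation g = 0"
    using centered_fourth_moment[OF assms(3) fb] by (auto simp: g_def)
  have c: "c = expectation (\<lambda>x. f x * g x)"
    by (simp add: c_def covariance_def f_def g_def)
  note ifg2 = integrable_mult_fourth(1)[OF _ _ f(1) g(1), simplified]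
    and ifg = integrable_mult_fourth(2)[OF _ _ f(1) g(1), simplified]
    and fg2_le = integrable_mult_fourth(3)[OF _ _ f(1) g(1), simplified]
  have fg2: "expectation (\<lambda>x. (f x * g x)\<^sup>2) \<le> 16 * C"
    using fg2_le f(2) g(2) by linarith
  have var: "expectation (\<lambda>x. (f x * g x - c)\<^sup>2) = expectation (\<lambda>x. (f x * g x)\<^sup>2) - c\<^sup>2"
    using variance_eq[OF ifg ifg2] by (simp add: c)
  moreover have "0 \<le> expectation (\<lambda>x. (f x * g x - c)\<^sup>2)"
    by simp
  ultimately show c2: "c\<^sup>2 \<le> 16 * C"
    using fg2 by linarith
  define p where "p = (\<lambda>x. f x * g x - c)"
  have [measurable]: "p \<in> borel_measurable M"
    unfolding p_def by measurable
  have p2i: "integrable M (\<lambda>x. (p x)\<^sup>2)"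
    using ifg ifg2 unfolding p_def power2_diff
    by (intro Bochner_Integration.integrable_add Bochner_Integration.integrable_diff
        integrable_mult_left integrable_mult_right) auto
  have p2: "expectation (\<lambda>x. (p x)\<^sup>2) \<le> 16 * C"
    using var fg2 zero_le_power2[of c] unfolding p_def by linarith
  have p0: "expectation p = 0"
    using ifg by (simp add: p_def c prob_space)
  have indep: "P.indep_vars (\<lambda>_. borel) (\<lambda>i x. h (x i)) {..<n}"
    if "h \<in> borel_measurable M" for h :: "'c \<Rightarrow> real"
    using n that by (intro P.indep_vars_compose2[OF indep_vars_PiM_coordinates]) (auto simp: \<open>prob_space M\<close> lessThan_empty_iff)
  have coord: "integral\<^sup>L (\<Pi>\<^sub>M i\<in>{..<n}. M) (\<lambda>x. h (x i)) = expectation h"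
      "integrable M h \<Longrightarrow> integrable (\<Pi>\<^sub>M i\<in>{..<n}. M) (\<lambda>x. h (x i))"
    if "i < n" and [measurable]: "h \<in> borel_measurable M" for h :: "'c \<Rightarrow> real" and i
  proof -
    have d: "distr (\<Pi>\<^sub>M i\<in>{..<n}. M) M (\<lambda>x. x i) = M"
      using that by (intro distr_PiM_component) (auto simp: \<open>prob_space M\<close>)
    have m: "(\<lambda>x. x i) \<in> measurable (\<Pi>\<^sub>M i\<in>{..<n}. M) M"
      using that by (intro measurable_component_singleton) auto
    show "integral\<^sup>L (\<Pi>\<^sub>M i\<in>{..<n}. M) (\<lambda>x. h (x i)) = expectation h"
      using integral_distr[OF m that(2)] unfolding d by (rule sym)
    show "integrable (\<Pi>\<^sub>M i\<in>{..<n}. M) (\<lambda>x. h (x i))" if "integrable M h"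
      using integrable_distr[OF m, of h] that unfolding d by blast
  qed
  have psum: "\<And>i. i < n \<Longrightarrow> integrable (\<Pi>\<^sub>M i\<in>{..<n}. M) (\<lambda>x. (p (x i))\<^sup>2)"
      "\<And>i. i < n \<Longrightarrow> P.expectation (\<lambda>x. p (x i)) = 0"
      "\<And>i. i < n \<Longrightarrow> P.expectation (\<lambda>x. (p (x i))\<^sup>2) \<le> 16 * C"
    using coord(2)[OF _ _ p2i] coord(1)[of _ p] coord(1)[of _ "\<lambda>x. (p x)\<^sup>2"] p0 p2 by auto
  have pm: "integrable (\<Pi>\<^sub>M i\<in>{..<n}. M) (\<lambda>x. (\<Sum>i<n. p (x i))\<^sup>2)"
      "P.expectation (\<lambda>x. (\<Sum>i<n. p (x i))\<^sup>2) \<le> real n * (16 * C)"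
    by (rule P.second_moment_indep_sum[OF indep psum]; simp)+
  have sum4: "integrable (\<Pi>\<^sub>M i\<in>{..<n}. M) (\<lambda>x. (\<Sum>i<n. h (x i)) ^ 4)"
      "P.expectation (\<lambda>x. (\<Sum>i<n. h (x i)) ^ 4) \<le> 3 * (real n)\<^sup>2 * (16 * C)"
    if [measurable]: "h \<in> borel_measurable M" and h: "integrable M (\<lambda>x. h x ^ 4)"
      "expectation (\<lambda>x. h x ^ 4) \<le> 16 * C" "expectation h = 0" for h :: "'c \<Rightarrow> real"
  proof -
    have "(expectation (\<lambda>x. (h x)\<^sup>2))\<^sup>2 \<le> 16 * C"
      using power_four_expectation_le(1)[OF that(1) h(1)] h(2) by simp
    note h2 = this
    have hsum: "\<And>i. i < n \<Longrightarrow> integrable (\<Pi>\<^sub>M i\<in>{..<n}. M) (\<lambda>x. h (x i) ^ 4)"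
        "\<And>i. i < n \<Longrightarrow> P.expectation (\<lambda>x. h (x i)) = 0"
        "\<And>i. i < n \<Longrightarrow> P.expectation (\<lambda>x. (h (x i))\<^sup>2) \<le> expectation (\<lambda>x. (h x)\<^sup>2)"
        "\<And>i. i < n \<Longrightarrow> P.expectation (\<lambda>x. h (x i) ^ 4) \<le> 16 * C"
      using coord(2)[OF _ _ h(1)] coord(1)[of _ h] coord(1)[of _ "\<lambda>x. (h x)\<^sup>2"]
        coord(1)[of _ "\<lambda>x. h x ^ 4"] h(2,3) by auto
    show "integrable (\<Pi>\<^sub>M i\<in>{..<n}. M) (\<lambda>x. (\<Sum>i<n. h (x i)) ^ 4)"
      "P.expectation (\<lambda>x. (\<Sum>i<n. h (x i)) ^ 4) \<le> 3 * (real n)\<^sup>2 * (16 * C)"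
      by (rule P.fourth_moment_indep_sum[OF indep hsum]; use h2 in simp)+
  qed
  note fm = sum4[OF _ f] and gm = sum4[OF _ g]
  define B where "B x = 12 * ((\<Sum>i<n. p (x i))\<^sup>2 / (real n)\<^sup>2
     + ((\<Sum>i<n. f (x i)) ^ 4 + (\<Sum>i<n. g (x i)) ^ 4) / (2 * (real n) ^ 4) + c\<^sup>2 / (real n)\<^sup>2)" for x
  have Bi: "integrable (\<Pi>\<^sub>M i\<in>{..<n}. M) B"
    unfolding B_def using pm fm gm by simp
  have B0: "0 \<le> B x" for x
    unfolding B_def by simp
  have "sample_cov n (\<lambda>i. a (x i)) (\<lambda>i. b (x i)) = sample_cov n (\<lambda>i. f (x i)) (\<lambda>i. g (x i))" for x
    using n by (simp add: f_def g_def sample_cov_shift)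
  then have "(\<integral>\<^sup>+ x. ennreal ((sample_cov n (\<lambda>i. a (x i)) (\<lambda>i. b (x i)) - c)\<^sup>2) \<partial>(\<Pi>\<^sub>M i\<in>{..<n}. M))
      \<le> (\<integral>\<^sup>+ x. ennreal (B x) \<partial>(\<Pi>\<^sub>M i\<in>{..<n}. M))"
    using sample_cov_error_le[OF n] by (intro nn_integral_mono ennreal_leI) (auto simp: B_def p_def)
  also have "\<dots> = ennreal (P.expectation B)"
    using Bi B0 by (intro nn_integral_eq_integral) auto
  also have "P.expectation B \<le> 960 * C / real n"
  proof -
    have "P.expectation B = 12 * (P.expectation (\<lambda>x. (\<Sum>i<n. p (x i))\<^sup>2) / (real n)\<^sup>2
     + (P.expectation (\<lambda>x. (\<Sum>i<n. f (x i)) ^ 4) + P.expectation (\<lambda>x. (\<Sum>i<n. g (x i)) ^ 4)) / (2 * (real n) ^ 4)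
     + c\<^sup>2 / (real n)\<^sup>2)"
      unfolding B_def using pm fm gm by (simp add: P.prob_space)
    also have "\<dots> \<le> 12 * (real n * (16 * C) / (real n)\<^sup>2
     + (3 * (real n)\<^sup>2 * (16 * C) + 3 * (real n)\<^sup>2 * (16 * C)) / (2 * (real n) ^ 4) + 16 * C / (real n)\<^sup>2)"
      using pm fm gm c2 by (intro mult_left_mono add_mono divide_right_mono) auto
    also have "\<dots> = 12 * (16 * C / real n + (64 * C / real n) / real n)"
      using n by (simp add: power2_eq_square eval_nat_numeral field_simps)
    also have "\<dots> \<le> 12 * (16 * C / real n + 64 * C / real n)"
      using n C divide_left_mono[of 1 "real n" "64 * C / real n"] by simp
    finally show ?thesis by simp
  qed
  finally show "(\<integral>\<^sup>+ x. ennreal ((sample_cov n (\<lambda>i. a (x i)) (\<lambda>i. b (x i)) - c)\<^sup>2) \<partial>(\<Pi>\<^sub>M i\<in>{..<n}. M))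
      \<le> ennreal (960 * C / real n)" by (simp add: ennreal_leI)
qed

section \<open>Descent along a single run\<close>

text \<open>\<open>gradient\<close> is a definite description, so existence and uniqueness are both
  required: the derivative, a linear functional, is represented by the vector of its values on the
  basis, and Frechet derivatives are unique.\<close>

lemma differentiable_imp_gderiv:
  fixes f :: "'v::euclidean_space \<Rightarrow> real"
  assumes "f differentiable (at t)"
  shows "GDERIV f t :> gradient f t"
proof -
  obtain f' where f': "(f has_derivative f') (at t)"
    using assms by (auto simp: differentiable_def)
  interpret f': bounded_linear f'
    using f' by (rule has_derivative_bounded_linear)
  define d where "d = (\<Sum>b\<in>Basis. f' b *\<^sub>R b)"
  have f'_eq: "f' h = d \<bullet> h" for h
  proof -
    have "f' h = f' (\<Sum>b\<in>Basis. (h \<bullet> b) *\<^sub>R b)"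
      by (simp add: euclidean_representation)
    also have "\<dots> = d \<bullet> h"
      by (simp add: f'.sum f'.scaleR d_def inner_sum_left inner_commute[of h] mult.commute)
    finally show ?thesis .
  qed
  have d: "GDERIV f t :> d"
    using f' by (simp add: gderiv_def f'_eq[abs_def] inner_commute)
  have "d' = d" if "GDERIV f t :> d'" for d'
  proof -
    have "(\<lambda>h. h \<bullet> d') = (\<lambda>h. h \<bullet> d)"
      by (rule has_derivative_unique) (use that d in \<open>auto simp: gderiv_def\<close>)
    then have "\<forall>h. h \<bullet> d' = h \<bullet> d"
      by (simp add: fun_eq_iff)
    then show ?thesis
      by (simp only: vector_eq_rdot vector_eq_ldot)
  qed
  with d show ?thesis
    unfolding gradient_def by (rule theI)
qed

text \<open>The usual integral along the segment is replaced by monotonicity: \<open>h\<close> is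
  the defect of the bound at \<open>x + s *\<^sub>R v\<close>, and Cauchy-Schwarz with the Lipschitz
  condition makes its derivative nonpositive for \<open>s \<ge> 0\<close>.\<close>

lemma lipschitz_gradient_descent:
  fixes f :: "'v::euclidean_space \<Rightarrow> real"
  assumes deriv: "\<And>x. GDERIV f x :> g x"
    and lip: "\<And>x y. norm (g x - g y) \<le> C * norm (x - y)"
  shows "f (x + v) \<le> f x + g x \<bullet> v + C / 2 * (norm v)\<^sup>2"
proof -
  define h where "h s = f (x + s *\<^sub>R v) - s * (g x \<bullet> v) - C / 2 * s\<^sup>2 * (norm v)\<^sup>2" for s :: real
  have dh: "(h has_real_derivative (g (x + s *\<^sub>R v) - g x) \<bullet> v - C * s * (norm v)\<^sup>2) (at s)" for s
  proof -
    have 1: "(f has_derivative (\<lambda>u. u \<bullet> g (x + s *\<^sub>R v))) (at (x + s *\<^sub>R v))"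
      using deriv by (simp add: gderiv_def inner_commute)
    have 2: "((\<lambda>s. x + s *\<^sub>R v) has_derivative (\<lambda>u. u *\<^sub>R v)) (at s)"
      by (auto intro!: derivative_eq_intros)
    have "((\<lambda>s. f (x + s *\<^sub>R v)) has_derivative (\<lambda>u. (u *\<^sub>R v) \<bullet> g (x + s *\<^sub>R v))) (at s)"
      using has_derivative_compose[OF 2 1] .
    then have "((\<lambda>s. f (x + s *\<^sub>R v)) has_real_derivative (g (x + s *\<^sub>R v) \<bullet> v)) (at s)"
      by (simp add: has_field_derivative_def inner_commute[of v] mult_commute_abs)
    then show ?thesis
      unfolding h_def by (auto intro!: derivative_eq_intros simp: inner_diff_left algebra_simps)
  qed
  have dh_le: "(g (x + s *\<^sub>R v) - g x) \<bullet> v - C * s * (norm v)\<^sup>2 \<le> 0" if "0 \<le> s" for s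
  proof -
    have "(g (x + s *\<^sub>R v) - g x) \<bullet> v \<le> norm (g (x + s *\<^sub>R v) - g x) * norm v"
      by (rule norm_cauchy_schwarz)
    also have "\<dots> \<le> (C * norm ((x + s *\<^sub>R v) - x)) * norm v"
      by (intro mult_right_mono lip) simp
    also have "\<dots> = C * s * (norm v)\<^sup>2"
      using that by (simp add: power2_eq_square)
    finally show ?thesis by simp
  qed
  have "h 1 \<le> h 0"
  proof (rule DERIV_nonpos_imp_nonincreasing[where a=0 and b=1 and f=h])
    fix s :: real assume "0 \<le> s"
    with dh dh_le show "\<exists>y. (h has_real_derivative y) (at s) \<and> y \<le> 0"
      by blast
  qed simp
  then show ?thesis
    by (simp add: h_def)
qed

text \<open>
  The preconditioner noise \<open>S k - T k\<close> enters only paired with the bounded vector \<open>g (x k)\<close>, so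
  Young's inequality splits off its square without moments of products with \<open>D (Suc k)\<close>.
\<close>

lemma spring_pathwise_bound:
  fixes L :: "'v::euclidean_space \<Rightarrow> real" and g :: "'v \<Rightarrow> 'v"
    and x D gh :: "nat \<Rightarrow> 'v" and S T :: "nat \<Rightarrow> 'v \<Rightarrow> 'v" and \<eta> e :: "nat \<Rightarrow> real"
  assumes smooth: "\<And>x v. L (x + v) \<le> L x + g x \<bullet> v + Cg / 2 * (norm v)\<^sup>2"
    and lower: "\<And>x. - B \<le> L x" and g_le: "\<And>x. norm (g x) \<le> G"
    and D_eq: "\<And>k. lam *\<^sub>R D (Suc k) + S k (D (Suc k)) = (lam * \<mu>) *\<^sub>R D k - (1/2) *\<^sub>R gh k"
    and x_Suc: "\<And>k. x (Suc k) = x k + \<eta> k *\<^sub>R D (Suc k)"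
    and S_psd: "\<And>k v. 0 \<le> v \<bullet> S k v"
    and T_le: "\<And>k v. norm (T k v) \<le> s * norm v"
    and ST: "\<And>k v. norm (S k v - T k v) \<le> e k * norm v"
    and lam: "0 < lam" and \<mu>: "0 \<le> \<mu>" "\<mu> < 1" and Cg: "0 < Cg" and s: "0 \<le> s"
    and e: "\<And>k. 0 \<le> e k"
    and \<eta>: "\<And>k. 0 < \<eta> k" "\<And>k. \<eta> (Suc k) \<le> \<eta> k" "\<eta> 0 \<le> 2 * lam * (1 - \<mu>) / Cg"
  defines "c \<equiv> lam * (1 - \<mu>)"
  defines "A \<equiv> 3 * (4 * lam\<^sup>2 + (2 * lam + 2 * s)\<^sup>2 + 1) + 2 * G"
  shows "(\<Sum>k=1..K. \<eta> k * (norm (g (x k)))\<^sup>2)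
     \<le> 4 * A / c * (L (x 0) + B + lam * \<mu> * \<eta> 0 * (norm (D 0))\<^sup>2)
       + A * (2 / c\<^sup>2 + 1) * (\<Sum>k\<le>K. \<eta> k * ((norm (gh k - g (x k)))\<^sup>2 + (e k)\<^sup>2))"
proof -
  have c: "0 < c"
    using lam \<mu> by (simp add: c_def)
  have G: "0 \<le> G"
    using g_le[of "x 0"] norm_ge_zero order_trans by blast
  have \<eta>0: "0 \<le> \<eta> k" for k
    using \<eta>(1)[of k] by simp
  have A: "0 \<le> A"
    using G by (simp add: A_def)
  \<comment> \<open>In this form the step-size restriction says
    \<open>Cg * \<eta> k / 2 \<le> c\<close>, so the quadratic term of the descent inequality costs
    at most \<open>c * \<eta> k\<close> times the squared increment.\<close>
  have \<eta>_le: "\<eta> k \<le> 2 * c / Cg" for k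
  proof (induction k)
    case 0
    then show ?case using \<eta>(3) by (simp add: c_def mult.assoc)
  next
    case (Suc k)
    with \<eta>(2)[of k] show ?case by linarith
  qed
  define eps where "eps k = gh k - g (x k)" for k
  \<comment> \<open>The kinetic term pays for the half of the momentum cross term that Young's
    inequality assigns to the old increment; adding \<open>B\<close> makes the potential
    nonnegative.\<close>
  define \<Phi> where "\<Phi> k = L (x k) + B + lam * \<mu> * \<eta> k * (norm (D k))\<^sup>2" for k
  have \<Phi>0: "0 \<le> \<Phi> k" for k
    using lower[of "x k"] lam \<mu> \<eta>(1)[of k] by (simp add: \<Phi>_def)
  have gh: "gh k = (2 * lam * \<mu>) *\<^sub>R D k - (2 * lam) *\<^sub>R D (Suc k) - 2 *\<^sub>R S k (D (Suc k))" for k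
  proof -
    have "(1/2) *\<^sub>R gh k = (lam * \<mu>) *\<^sub>R D k - lam *\<^sub>R D (Suc k) - S k (D (Suc k))"
      using D_eq[of k] by (simp add: algebra_simps)
    then have "2 *\<^sub>R ((1/2) *\<^sub>R gh k) = 2 *\<^sub>R ((lam * \<mu>) *\<^sub>R D k - lam *\<^sub>R D (Suc k) - S k (D (Suc k)))"
      by simp
    then show ?thesis
      by (simp add: scaleR_diff_right mult_ac)
  qed
  have young: "a \<bullet> b \<le> (norm a)\<^sup>2 / 2 + (norm b)\<^sup>2 / 2" for a b :: 'v
    using norm_cauchy_schwarz[of a b] zero_le_power2[of "norm a - norm b"]
    by (simp add: power2_eq_square algebra_simps)
  \<comment> \<open>Coefficient of the squared new increment, per unit of \<open>\<eta> k\<close>: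
    \<open>- 2 * lam\<close> from the iteration, \<open>lam * \<mu>\<close> from the momentum cross
    term, \<open>lam * \<mu>\<close> from the new potential, \<open>c\<close> from smoothness and
    \<open>c / 2\<close> from Young's inequality for the noise. The sum is
    \<open>- 2 * c + 3 * c / 2 = - c / 2\<close>. The form \<open>S k\<close> only helps, being
    nonnegative.\<close>
  have step: "\<Phi> (Suc k) + c / 2 * (\<eta> k * (norm (D (Suc k)))\<^sup>2) \<le> \<Phi> k + 1 / (2 * c) * (\<eta> k * (norm (eps k))\<^sup>2)" for k
  proof -
    define d0 d1 where "d0 = D k" and "d1 = D (Suc k)"
    have "g (x k) = gh k - eps k"
      by (simp add: eps_def)
    then have "g (x k) \<bullet> d1 = (2 * lam * \<mu>) * (d0 \<bullet> d1) - 2 * lam * (norm d1)\<^sup>2 - 2 * (d1 \<bullet> S k d1) - eps k \<bullet> d1"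
      by (simp add: gh d0_def d1_def inner_diff_left power2_norm_eq_inner inner_commute[of "S _ _"])
    moreover have "(2 * lam * \<mu>) * (d0 \<bullet> d1) \<le> (2 * lam * \<mu>) * ((norm d0)\<^sup>2 / 2 + (norm d1)\<^sup>2 / 2)"
      using lam \<mu> young[of d0 d1] by (intro mult_left_mono) auto
    moreover have "- (eps k \<bullet> d1) \<le> (norm (eps k))\<^sup>2 / (2 * c) + c / 2 * (norm d1)\<^sup>2"
    proof -
      have "- (eps k \<bullet> d1) \<le> norm (eps k) * norm d1"
        using norm_cauchy_schwarz[of "- eps k" d1] by simp
      also have "\<dots> \<le> (norm (eps k))\<^sup>2 / (2 * c) + c / 2 * (norm d1)\<^sup>2"
        using zero_le_power2[of "norm (eps k) - c * norm d1"] c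
        by (simp add: power2_eq_square field_simps)
      finally show ?thesis .
    qed
    ultimately have "g (x k) \<bullet> d1 \<le> (2 * lam * \<mu>) * ((norm d0)\<^sup>2 / 2 + (norm d1)\<^sup>2 / 2) - 2 * lam * (norm d1)\<^sup>2
        + ((norm (eps k))\<^sup>2 / (2 * c) + c / 2 * (norm d1)\<^sup>2)"
      using S_psd[of d1 k] by linarith
    then have g_d1: "g (x k) \<bullet> d1 \<le> lam * \<mu> * (norm d0)\<^sup>2 + (lam * \<mu> - 2 * lam + c / 2) * (norm d1)\<^sup>2
        + (norm (eps k))\<^sup>2 / (2 * c)"
      by (simp add: algebra_simps)
    have "L (x (Suc k)) \<le> L (x k) + \<eta> k * (g (x k) \<bullet> d1) + Cg / 2 * (norm (\<eta> k *\<^sub>R d1))\<^sup>2"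
      using smooth[of "x k" "\<eta> k *\<^sub>R d1"] by (simp add: x_Suc d1_def)
    moreover have "Cg / 2 * (norm (\<eta> k *\<^sub>R d1))\<^sup>2 \<le> \<eta> k * (c * (norm d1)\<^sup>2)"
    proof -
      have "Cg / 2 * (norm (\<eta> k *\<^sub>R d1))\<^sup>2 = \<eta> k * ((Cg * \<eta> k / 2) * (norm d1)\<^sup>2)"
        by (simp add: power2_eq_square)
      also have "\<dots> \<le> \<eta> k * (c * (norm d1)\<^sup>2)"
        using \<eta>(1)[of k] \<eta>_le[of k] Cg by (intro mult_left_mono mult_right_mono) (auto simp: field_simps)
      finally show ?thesis .
    qed
    moreover have "\<eta> k * (g (x k) \<bullet> d1) \<le> \<eta> k * (lam * \<mu> * (norm d0)\<^sup>2 + (lam * \<mu> - 2 * lam + c / 2) * (norm d1)\<^sup>2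
        + (norm (eps k))\<^sup>2 / (2 * c))"
      using \<eta>(1)[of k] g_d1 by (intro mult_left_mono) auto
    ultimately have L: "L (x (Suc k)) \<le> L (x k) + \<eta> k * (lam * \<mu> * (norm d0)\<^sup>2 + (lam * \<mu> - 2 * lam + c / 2) * (norm d1)\<^sup>2
        + (norm (eps k))\<^sup>2 / (2 * c)) + \<eta> k * (c * (norm d1)\<^sup>2)"
      by linarith
    \<comment> \<open>The new potential carries the weight \<open>\<eta> (Suc k)\<close>;
      nonincreasing step sizes bring it to the weight \<open>\<eta> k\<close> of all other
      terms.\<close>
    have "lam * \<mu> * \<eta> (Suc k) * (norm d1)\<^sup>2 \<le> lam * \<mu> * \<eta> k * (norm d1)\<^sup>2"
      using lam \<mu> \<eta>(2)[of k] by (intro mult_right_mono mult_left_mono) auto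
    with L show ?thesis
      unfolding \<Phi>_def d0_def[symmetric] d1_def[symmetric] by (simp add: c_def algebra_simps add_divide_distrib diff_divide_distrib)
  qed
  have "\<Phi> m + c / 2 * (\<Sum>k<m. \<eta> k * (norm (D (Suc k)))\<^sup>2) \<le> \<Phi> 0 + 1 / (2 * c) * (\<Sum>k<m. \<eta> k * (norm (eps k))\<^sup>2)" for m
  proof (induction m)
    case (Suc m)
    with step[of m] show ?case
      by (simp add: distrib_left)
  qed simp
  from this[of "Suc K"] \<Phi>0[of "Suc K"]
  have "c / 2 * (\<Sum>k\<le>K. \<eta> k * (norm (D (Suc k)))\<^sup>2) \<le> \<Phi> 0 + 1 / (2 * c) * (\<Sum>k\<le>K. \<eta> k * (norm (eps k))\<^sup>2)"
    unfolding lessThan_Suc_atMost by linarith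
  then have "2 / c * (c / 2 * (\<Sum>k\<le>K. \<eta> k * (norm (D (Suc k)))\<^sup>2))
      \<le> 2 / c * (\<Phi> 0 + 1 / (2 * c) * (\<Sum>k\<le>K. \<eta> k * (norm (eps k))\<^sup>2))"
    using c by (intro mult_left_mono) auto
  then have sum_D: "(\<Sum>k\<le>K. \<eta> k * (norm (D (Suc k)))\<^sup>2) \<le> 2 / c * \<Phi> 0 + 1 / c\<^sup>2 * (\<Sum>k\<le>K. \<eta> k * (norm (eps k))\<^sup>2)"
    using c by (simp add: power2_eq_square distrib_left)
  \<comment> \<open>Inside \<open>y\<close> the operator \<open>S k\<close> is replaced by
    \<open>T k\<close>, which has the uniform bound \<open>s\<close>. In \<open>A\<close>, the outer
    3 comes from squaring a sum of three terms and \<open>2 * G\<close> from Young's inequality for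
    the remainder \<open>S k - T k\<close>.\<close>
  have grad: "(norm (g (x k)))\<^sup>2 \<le> A * ((norm (D k))\<^sup>2 + (norm (D (Suc k)))\<^sup>2 + ((norm (eps k))\<^sup>2 + (e k)\<^sup>2))" for k
  proof -
    define u where "u = g (x k)"
    define d0 d1 where "d0 = norm (D k)" and "d1 = norm (D (Suc k))"
    define y where "y = (2 * lam * \<mu>) *\<^sub>R D k - (2 * lam) *\<^sub>R D (Suc k) - 2 *\<^sub>R T k (D (Suc k)) - eps k"
    have "u = y - 2 *\<^sub>R (S k (D (Suc k)) - T k (D (Suc k)))"
      using gh[of k] by (simp add: u_def y_def eps_def algebra_simps)
    then have "(norm u)\<^sup>2 = u \<bullet> y - 2 * (u \<bullet> (S k (D (Suc k)) - T k (D (Suc k))))"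
      using arg_cong[of u _ "inner u"] by (simp only: power2_norm_eq_inner inner_diff_right inner_scaleR_right)
    moreover have "u \<bullet> y \<le> (norm u)\<^sup>2 / 2 + (norm y)\<^sup>2 / 2"
      by (rule young)
    moreover have "- (u \<bullet> (S k (D (Suc k)) - T k (D (Suc k)))) \<le> G * (e k * d1)"
    proof -
      have "- (u \<bullet> (S k (D (Suc k)) - T k (D (Suc k)))) \<le> norm u * norm (S k (D (Suc k)) - T k (D (Suc k)))"
        using norm_cauchy_schwarz[of "- u" "S k (D (Suc k)) - T k (D (Suc k))"] by simp
      also have "\<dots> \<le> G * (e k * d1)"
        using g_le[of "x k"] ST[of k "D (Suc k)"] G by (intro mult_mono) (auto simp: u_def d1_def)
      finally show ?thesis .
    qed
    ultimately have 1: "(norm u)\<^sup>2 \<le> (norm y)\<^sup>2 + 4 * (G * (e k * d1))"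
      by linarith
    have "4 * (G * (e k * d1)) \<le> 2 * G * ((e k)\<^sup>2 + d1\<^sup>2)"
      using mult_left_mono[OF zero_le_power2[of "e k - d1"], of "2 * G"] G
      by (simp add: power2_eq_square algebra_simps)
    with 1 have 2: "(norm u)\<^sup>2 \<le> (norm y)\<^sup>2 + 2 * G * ((e k)\<^sup>2 + d1\<^sup>2)"
      by linarith
    have "norm y \<le> norm ((2 * lam * \<mu>) *\<^sub>R D k) + norm ((2 * lam) *\<^sub>R D (Suc k)) + norm (2 *\<^sub>R T k (D (Suc k))) + norm (eps k)"
    proof -
      have "norm (p - q - r - t) \<le> norm p + norm q + norm r + norm t" for p q r t :: 'v
        using norm_triangle_ineq4[of "p - q - r" t] norm_triangle_ineq4[of "p - q" r]
          norm_triangle_ineq4[of p q] by linarith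
      then show ?thesis
        unfolding y_def .
    qed
    also have "\<dots> \<le> (2 * lam) * d0 + (2 * lam + 2 * s) * d1 + norm (eps k)"
    proof -
      have "2 * lam * \<mu> * d0 \<le> 2 * lam * 1 * d0"
        using lam \<mu> by (intro mult_right_mono mult_left_mono) (auto simp: d0_def)
      moreover have "norm ((2 * lam * \<mu>) *\<^sub>R D k) = 2 * lam * \<mu> * d0"
          "norm ((2 * lam) *\<^sub>R D (Suc k)) = 2 * lam * d1"
        using lam \<mu> by (simp_all add: d0_def d1_def)
      moreover have "norm (2 *\<^sub>R T k (D (Suc k))) \<le> 2 * s * d1"
        using T_le[of k "D (Suc k)"] by (simp add: d1_def)
      ultimately show ?thesis
        by (simp add: distrib_right)
    qed
    finally have "(norm y)\<^sup>2 \<le> ((2 * lam) * d0 + (2 * lam + 2 * s) * d1 + norm (eps k))\<^sup>2"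
      by (rule power_mono) simp
    also have "\<dots> \<le> 3 * (((2 * lam) * d0)\<^sup>2 + ((2 * lam + 2 * s) * d1)\<^sup>2 + (norm (eps k))\<^sup>2)"
    proof -
      have "(p + q + r)\<^sup>2 \<le> 3 * (p\<^sup>2 + q\<^sup>2 + r\<^sup>2)" for p q r :: real
        using zero_le_power2[of "p - q"] zero_le_power2[of "q - r"] zero_le_power2[of "p - r"]
        by (simp add: power2_eq_square algebra_simps)
      then show ?thesis .
    qed
    also have "\<dots> = 3 * (4 * lam\<^sup>2 * d0\<^sup>2 + (2 * lam + 2 * s)\<^sup>2 * d1\<^sup>2 + 1 * (norm (eps k))\<^sup>2)"
      by (simp add: power_mult_distrib)
    finally have "(norm u)\<^sup>2 \<le> 3 * (4 * lam\<^sup>2 * d0\<^sup>2 + (2 * lam + 2 * s)\<^sup>2 * d1\<^sup>2 + 1 * (norm (eps k))\<^sup>2)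
        + 2 * G * ((e k)\<^sup>2 + d1\<^sup>2)"
      using 2 by linarith
    also have "\<dots> = 3 * (4 * lam\<^sup>2) * d0\<^sup>2 + (3 * (2 * lam + 2 * s)\<^sup>2 + 2 * G) * d1\<^sup>2 + 3 * (norm (eps k))\<^sup>2 + 2 * G * (e k)\<^sup>2"
      by (simp add: algebra_simps)
    also have "\<dots> \<le> A * d0\<^sup>2 + A * d1\<^sup>2 + A * (norm (eps k))\<^sup>2 + A * (e k)\<^sup>2"
      using G by (intro add_mono mult_right_mono) (auto simp: A_def)
    finally show ?thesis
      by (simp add: u_def d0_def d1_def algebra_simps)
  qed
  have "(\<Sum>k=1..K. \<eta> k * (norm (g (x k)))\<^sup>2)
      \<le> (\<Sum>k=1..K. A * (\<eta> k * (norm (D k))\<^sup>2 + \<eta> k * (norm (D (Suc k)))\<^sup>2 + \<eta> k * ((norm (eps k))\<^sup>2 + (e k)\<^sup>2)))"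
    using mult_left_mono[OF grad less_imp_le[OF \<eta>(1)]]
    by (intro sum_mono) (auto simp: algebra_simps)
  also have "\<dots> = A * ((\<Sum>k=1..K. \<eta> k * (norm (D k))\<^sup>2) + (\<Sum>k=1..K. \<eta> k * (norm (D (Suc k)))\<^sup>2)
      + (\<Sum>k=1..K. \<eta> k * ((norm (eps k))\<^sup>2 + (e k)\<^sup>2)))"
    by (simp only: sum_distrib_left[symmetric] sum.distrib)
  also have "\<dots> \<le> A * ((\<Sum>k\<le>K. \<eta> k * (norm (D (Suc k)))\<^sup>2) + (\<Sum>k\<le>K. \<eta> k * (norm (D (Suc k)))\<^sup>2)
      + (\<Sum>k\<le>K. \<eta> k * ((norm (eps k))\<^sup>2 + (e k)\<^sup>2)))"
  proof (intro mult_left_mono add_mono A)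
    \<comment> \<open>For \<open>k \<ge> 1\<close> the vector \<open>D k\<close> is the increment
      produced at step \<open>k - 1\<close>, and its weight may be raised to
      \<open>\<eta> (k - 1)\<close>. At index 0 there is no producing step, and the gradient sum
      starts at 1.\<close>
    have "(\<Sum>k=1..K. \<eta> k * (norm (D k))\<^sup>2) \<le> (\<Sum>k=1..K. \<eta> (k - 1) * (norm (D (Suc (k - 1))))\<^sup>2)"
    proof (intro sum_mono)
      fix k assume "k \<in> {1..K}"
      then obtain j where "k = Suc j"
        by (cases k) auto
      then show "\<eta> k * (norm (D k))\<^sup>2 \<le> \<eta> (k - 1) * (norm (D (Suc (k - 1))))\<^sup>2"
        using \<eta>(2)[of j] by (simp add: mult_right_mono)
    qed
    also have "\<dots> = (\<Sum>k<K. \<eta> k * (norm (D (Suc k)))\<^sup>2)"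
      by (rule sum.reindex_bij_witness[of _ Suc "\<lambda>k. k - 1"]) auto
    also have "\<dots> \<le> (\<Sum>k\<le>K. \<eta> k * (norm (D (Suc k)))\<^sup>2)"
      by (intro sum_mono2) (auto simp: \<eta>0)
    finally show "(\<Sum>k=1..K. \<eta> k * (norm (D k))\<^sup>2) \<le> (\<Sum>k\<le>K. \<eta> k * (norm (D (Suc k)))\<^sup>2)" .
    show "(\<Sum>k=1..K. \<eta> k * (norm (D (Suc k)))\<^sup>2) \<le> (\<Sum>k\<le>K. \<eta> k * (norm (D (Suc k)))\<^sup>2)"
      by (intro sum_mono2) (auto simp: \<eta>0)
    show "(\<Sum>k=1..K. \<eta> k * ((norm (eps k))\<^sup>2 + (e k)\<^sup>2)) \<le> (\<Sum>k\<le>K. \<eta> k * ((norm (eps k))\<^sup>2 + (e k)\<^sup>2))"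
      by (intro sum_mono2) (auto simp: \<eta>0)
  qed
  also have "\<dots> \<le> A * (2 * (2 / c * \<Phi> 0 + 1 / c\<^sup>2 * (\<Sum>k\<le>K. \<eta> k * ((norm (eps k))\<^sup>2 + (e k)\<^sup>2)))
      + (\<Sum>k\<le>K. \<eta> k * ((norm (eps k))\<^sup>2 + (e k)\<^sup>2)))"
  proof -
    have "(\<Sum>k\<le>K. \<eta> k * (norm (eps k))\<^sup>2) \<le> (\<Sum>k\<le>K. \<eta> k * ((norm (eps k))\<^sup>2 + (e k)\<^sup>2))"
      by (intro sum_mono mult_left_mono) (auto simp: \<eta>0)
    then have "1 / c\<^sup>2 * (\<Sum>k\<le>K. \<eta> k * (norm (eps k))\<^sup>2) \<le> 1 / c\<^sup>2 * (\<Sum>k\<le>K. \<eta> k * ((norm (eps k))\<^sup>2 + (e k)\<^sup>2))"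
      by (intro mult_left_mono) auto
    note D_le = order_trans[OF sum_D add_left_mono[OF this]]
    show ?thesis
      using add_mono[OF D_le D_le] by (intro mult_left_mono add_right_mono A) (simp only: mult_2)
  qed
  also have "\<dots> = 4 * A / c * \<Phi> 0 + A * (2 / c\<^sup>2 + 1) * (\<Sum>k\<le>K. \<eta> k * ((norm (eps k))\<^sup>2 + (e k)\<^sup>2))"
    by (simp add: algebra_simps)
  finally show ?thesis
    by (simp add: \<Phi>_def eps_def)
qed

section \<open>Frobenius norms and the regularised linear system\<close>

lemma norm_matrix_vector_le: "norm (A *v x) \<le> norm A * norm x"
  for A :: "real^'n^'m" and x :: "real^'n"
proof -
  have "norm ((A *v x) $ i) \<le> norm (A $ i) * norm x" for i
    using Cauchy_Schwarz_ineq2[of "A $ i" x] by (simp add: matrix_vector_mul_component)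
  then have "norm (A *v x) \<le> L2_set (\<lambda>i. norm (A $ i) * norm x) UNIV"
    unfolding norm_vec_def[of "A *v x"] by (intro L2_set_mono) auto
  also have "\<dots> = norm A * norm x"
    by (simp add: norm_vec_def[of A] L2_set_left_distrib)
  finally show ?thesis .
qed

lemma power2_norm_vec: "(norm x)\<^sup>2 = (\<Sum>i\<in>UNIV. (x $ i)\<^sup>2)" for x :: "real^'n"
  by (simp add: norm_vec_def L2_set_def sum_nonneg)

lemma power2_norm_matrix: "(norm A)\<^sup>2 = (\<Sum>i\<in>UNIV. \<Sum>j\<in>UNIV. (A $ i $ j)\<^sup>2)" for A :: "real^'n^'m"
  by (simp add: norm_vec_def[of A] L2_set_def sum_nonneg power2_norm_vec)

lemma outer_product_mult_vec: "outer_product u v *v x = (v \<bullet> x) *\<^sub>R u"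
  by (simp add: outer_product_def matrix_vector_mult_def vec_eq_iff inner_vec_def
      sum_distrib_left mult_ac)

text \<open>The quadratic form is a sum of squares of inner products with the centred log-gradients,
  divided by the positive number \<open>n - 1\<close>.\<close>

lemma batch_S_psd:
  assumes "n \<ge> 2"
  shows "0 \<le> v \<bullet> (batch_S \<psi> n t b *v v)"
proof -
  let ?o = "batch_centered_log_grad \<psi> n t b"
  have "(\<Sum>i\<in>I. outer_product (?o i) (?o i)) *v v = (\<Sum>i\<in>I. (?o i \<bullet> v) *\<^sub>R ?o i)" for I
    by (induction I rule: infinite_finite_induct)
       (simp_all add: matrix_vector_mult_add_rdistrib outer_product_mult_vec)
  then have "v \<bullet> (batch_S \<psi> n t b *v v) = (1 / (real n - 1)) * (\<Sum>i<n. (?o i \<bullet> v)\<^sup>2)"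
    by (simp add: batch_S_def scaleR_matrix_vector_assoc[symmetric] inner_sum_right power2_eq_square inner_commute)
  then show ?thesis
    using assms by (simp add: sum_nonneg)
qed

lemma invertible_shifted_psd:
  fixes S :: "real^'n^'n"
  assumes "0 < lam" and psd: "\<And>v. 0 \<le> v \<bullet> (S *v v)"
  shows "invertible (lam *\<^sub>R mat 1 + S)"
proof -
  have "v = 0" if "(lam *\<^sub>R mat 1 + S) *v v = 0" for v
  proof -
    have "0 = v \<bullet> ((lam *\<^sub>R mat 1 + S) *v v)"
      using that by simp
    also have "\<dots> = lam * (norm v)\<^sup>2 + v \<bullet> (S *v v)"
      by (simp add: matrix_vector_mult_add_rdistrib scaleR_matrix_vector_assoc[symmetric]
          inner_add_right power2_norm_eq_inner)
    finally have "lam * (norm v)\<^sup>2 \<le> 0"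
      using psd[of v] by linarith
    then show ?thesis
      using \<open>0 < lam\<close> by (simp add: mult_le_0_iff)
  qed
  then show ?thesis
    using matrix_left_invertible_ker invertible_left_inverse by blast
qed

text \<open>\<open>matrix_inv\<close> is a choice operator; invertibility makes the chosen matrix a
  two-sided inverse, so the update can be traded for its linear system.\<close>

lemma matrix_inv_mult_vec_eq_iff:
  fixes A :: "real^'n^'n"
  assumes "invertible A"
  shows "matrix_inv A *v w = x \<longleftrightarrow> A *v x = w"
proof -
  have "A ** matrix_inv A = mat 1 \<and> matrix_inv A ** A = mat 1"
    using assms unfolding invertible_def matrix_inv_def by (rule someI_ex)
  then show ?thesis
    by (metis matrix_vector_mul_assoc matrix_vector_mul_lid)
qed

section \<open>Conditional laws with a density, and measurability of the iterates\<close>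

text \<open>Both sides agree on boxes, by factorising the integral of a product. This puts the batch
  laws for all parameters on one fixed base measure.\<close>

lemma PiM_density:
  assumes "finite I" and "sigma_finite_measure Q" and [measurable]: "f \<in> borel_measurable Q"
    and "sigma_finite_measure (density Q f)"
  shows "(\<Pi>\<^sub>M i\<in>I. density Q f) = density (\<Pi>\<^sub>M i\<in>I. Q) (\<lambda>x. \<Prod>i\<in>I. f (x i))"
proof -
  interpret Q: product_sigma_finite "\<lambda>_. Q"
    using assms(2) by (simp add: product_sigma_finite_def)
  interpret D: product_sigma_finite "\<lambda>_. density Q f"
    using assms(4) by (simp add: product_sigma_finite_def)
  show ?thesis
  proof (rule D.PiM_eqI[OF \<open>finite I\<close>, symmetric])
    show "sets (density (\<Pi>\<^sub>M i\<in>I. Q) (\<lambda>x. \<Prod>i\<in>I. f (x i))) = sets (\<Pi>\<^sub>M i\<in>I. density Q f)"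
      by (auto intro!: sets_PiM_cong)
  next
    fix A assume "\<And>i. i \<in> I \<Longrightarrow> A i \<in> sets (density Q f)"
    then have A[measurable]: "\<And>i. i \<in> I \<Longrightarrow> A i \<in> sets Q"
      by simp
    have "emeasure (density (\<Pi>\<^sub>M i\<in>I. Q) (\<lambda>x. \<Prod>i\<in>I. f (x i))) (Pi\<^sub>E I A)
        = (\<integral>\<^sup>+ x. (\<Prod>i\<in>I. f (x i)) * indicator (Pi\<^sub>E I A) x \<partial>(\<Pi>\<^sub>M i\<in>I. Q))"
      using A \<open>finite I\<close> by (intro emeasure_density sets_PiM_I_finite) auto
    also have "\<dots> = (\<integral>\<^sup>+ x. (\<Prod>i\<in>I. f (x i) * indicator (A i) (x i)) \<partial>(\<Pi>\<^sub>M i\<in>I. Q))"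
    proof (rule nn_integral_cong)
      fix x assume "x \<in> space (\<Pi>\<^sub>M i\<in>I. Q)"
      then have "x \<in> extensional I"
        by (auto simp: space_PiM PiE_def)
      then have "indicator (Pi\<^sub>E I A) x = (\<Prod>i\<in>I. indicator (A i) (x i) :: ennreal)"
        using \<open>finite I\<close> by (auto simp: indicator_def PiE_def Pi_def)
      then show "(\<Prod>i\<in>I. f (x i)) * indicator (Pi\<^sub>E I A) x = (\<Prod>i\<in>I. f (x i) * indicator (A i) (x i))"
        by (simp add: prod.distrib)
    qed
    also have "\<dots> = (\<Prod>i\<in>I. \<integral>\<^sup>+ x. f x * indicator (A i) x \<partial>Q)"
      using A \<open>finite I\<close> by (intro Q.product_nn_integral_prod) auto
    also have "\<dots> = (\<Prod>i\<in>I. emeasure (density Q f) (A i))"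
      using A by (intro prod.cong) (auto simp: emeasure_density)
    finally show "emeasure (density (\<Pi>\<^sub>M i\<in>I. Q) (\<lambda>x. \<Prod>i\<in>I. f (x i))) (Pi\<^sub>E I A)
        = (\<Prod>i\<in>I. emeasure (density Q f) (A i))" .
  qed
qed

text \<open>Exceptional null sets in \<open>law\<close> vary with \<open>A\<close>, so no kernel can
  be read off pointwise. Instead the joint law \<open>M1\<close> of \<open>T\<close> and
  \<open>Y\<close> is compared with \<open>M2\<close>, the density \<open>r\<close> over the law of
  \<open>T\<close> times \<open>MB\<close>. Rectangles form an intersection-stable generator, and
  each of them involves a single \<open>A\<close>; equality of the two measures then gives the
  formula for every measurable \<open>F\<close>.\<close>

lemma nn_integral_conditional_density:
  assumes "prob_space P" and sub: "subalgebra P G"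
    and T: "T \<in> measurable G MT" and Y[measurable]: "Y \<in> measurable P MB"
    and "sigma_finite_measure MB"
    and r[measurable]: "(\<lambda>(t, b). r t b) \<in> borel_measurable (MT \<Otimes>\<^sub>M MB)"
    and r_prob: "\<And>t. t \<in> space MT \<Longrightarrow> prob_space (density MB (r t))"
    and law: "\<And>A. A \<in> sets MB \<Longrightarrow> AE \<omega> in P.
        real_cond_exp P G (indicat_real {\<omega> \<in> space P. Y \<omega> \<in> A}) \<omega> = measure (density MB (r (T \<omega>))) A"
    and F[measurable]: "(\<lambda>(t, b). F t b) \<in> borel_measurable (MT \<Otimes>\<^sub>M MB)"
  shows "(\<integral>\<^sup>+ \<omega>. F (T \<omega>) (Y \<omega>) \<partial>P) = (\<integral>\<^sup>+ \<omega>. \<integral>\<^sup>+ b. F (T \<omega>) b \<partial>density MB (r (T \<omega>)) \<partial>P)"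
proof -
  interpret prob_space P by fact
  interpret finite_measure_subalgebra P G
    by unfold_locales (rule sub)
  interpret MB: sigma_finite_measure MB by fact
  have TP[measurable]: "T \<in> measurable P MT"
    using T measurable_from_subalg[OF sub] by blast
  have T_space: "T \<omega> \<in> space MT" if "\<omega> \<in> space P" for \<omega>
    using measurable_space[OF TP that] .
  interpret T: prob_space "distr P MT T"
    by (rule prob_space_distr) simp
  interpret TB: pair_sigma_finite "distr P MT T" MB ..
  have r_sec: "r t \<in> borel_measurable MB" if "t \<in> space MT" for t
    using measurable_compose[OF measurable_Pair1'[OF that] r] by simp
  have F_sec: "F t \<in> borel_measurable MB" if "t \<in> space MT" for t
    using measurable_compose[OF measurable_Pair1'[OF that] F] by simp
  define M1 where "M1 = distr P (MT \<Otimes>\<^sub>M MB) (\<lambda>\<omega>. (T \<omega>, Y \<omega>))"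
  define M2 where "M2 = density (distr P MT T \<Otimes>\<^sub>M MB) (\<lambda>(t, b). r t b)"
  have sets_TB: "sets (distr P MT T \<Otimes>\<^sub>M MB) = sets (MT \<Otimes>\<^sub>M MB)"
    by (rule sets_pair_measure_cong) auto
  have meas_TB: "measurable (distr P MT T \<Otimes>\<^sub>M MB) borel = measurable (MT \<Otimes>\<^sub>M MB) borel"
    by (rule measurable_cong_sets) (auto simp: sets_TB)
  have int2: "integral\<^sup>N M2 (\<lambda>(t, b). h t b) = (\<integral>\<^sup>+ \<omega>. \<integral>\<^sup>+ b. r (T \<omega>) b * h (T \<omega>) b \<partial>MB \<partial>P)"
    if [measurable]: "(\<lambda>(t, b). h t b) \<in> borel_measurable (MT \<Otimes>\<^sub>M MB)" for h
  proof -
    have "integral\<^sup>N M2 (\<lambda>(t, b). h t b) = (\<integral>\<^sup>+ z. (case z of (t, b) \<Rightarrow> r t b * h t b) \<partial>(distr P MT T \<Otimes>\<^sub>M MB))"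
      unfolding M2_def by (subst nn_integral_density) (auto simp: meas_TB split_beta' intro!: nn_integral_cong)
    also have "\<dots> = (\<integral>\<^sup>+ t. \<integral>\<^sup>+ b. r t b * h t b \<partial>MB \<partial>distr P MT T)"
      by (subst MB.nn_integral_fst[symmetric]) (auto simp: meas_TB)
    also have "\<dots> = (\<integral>\<^sup>+ \<omega>. \<integral>\<^sup>+ b. r (T \<omega>) b * h (T \<omega>) b \<partial>MB \<partial>P)"
      by (subst nn_integral_distr) auto
    finally show ?thesis .
  qed
  have "M1 = M2"
  proof (rule measure_eqI_generator_eq[OF Int_stable_pair_measure_generator[of MT MB]])
    show "{a \<times> b |a b. a \<in> sets MT \<and> b \<in> sets MB} \<subseteq> Pow (space MT \<times> space MB)"
      using sets.sets_into_space[of _ MT] sets.sets_into_space[of _ MB] by blast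
    show "sets M1 = sigma_sets (space MT \<times> space MB) {a \<times> b |a b. a \<in> sets MT \<and> b \<in> sets MB}"
      by (simp add: M1_def sets_pair_measure)
    show "sets M2 = sigma_sets (space MT \<times> space MB) {a \<times> b |a b. a \<in> sets MT \<and> b \<in> sets MB}"
      by (simp add: M2_def sets_TB) (simp add: sets_pair_measure)
    show "range (\<lambda>_::nat. space MT \<times> space MB) \<subseteq> {a \<times> b |a b. a \<in> sets MT \<and> b \<in> sets MB}"
      by auto
    show "(\<Union>i::nat. space MT \<times> space MB) = space MT \<times> space MB"
      by simp
    have "emeasure M1 (space MT \<times> space MB) \<le> 1"
    proof -
      have "prob_space M1"
        unfolding M1_def by (rule prob_space_distr) simp
      then show ?thesis
        by (rule prob_space.emeasure_le_1)
    qed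
    then show "emeasure M1 (space MT \<times> space MB) \<noteq> \<infinity>" for i :: nat
      by (auto simp: top_unique)
  next
    fix Z assume "Z \<in> {a \<times> b |a b. a \<in> sets MT \<and> b \<in> sets MB}"
    then obtain B A where Z: "Z = B \<times> A" and [measurable]: "B \<in> sets MT" "A \<in> sets MB"
      by auto
    define U where "U = T -` B \<inter> space P"
    define V where "V = {\<omega> \<in> space P. Y \<omega> \<in> A}"
    define m where "m \<omega> = measure (density MB (r (T \<omega>))) A" for \<omega>
    have "T -` B \<inter> space G \<in> sets G"
      using T by measurable
    then have U_G: "U \<in> sets G"
      using sub by (simp add: U_def subalgebra_def)
    have [measurable]: "U \<in> sets P" "V \<in> sets P"
      unfolding U_def V_def by measurable
    have em: "emeasure (density MB (r (T \<omega>))) A = (\<integral>\<^sup>+ b. r (T \<omega>) b * indicator A b \<partial>MB)"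
      if "\<omega> \<in> space P" for \<omega>
      using r_sec[OF T_space[OF that]] by (subst emeasure_density) auto
    have em': "emeasure (density MB (r (T \<omega>))) A = ennreal (m \<omega>)" and m: "0 \<le> m \<omega>" "m \<omega> \<le> 1"
      if "\<omega> \<in> space P" for \<omega>
    proof -
      interpret D: prob_space "density MB (r (T \<omega>))"
        by (rule r_prob[OF T_space[OF that]])
      show "emeasure (density MB (r (T \<omega>))) A = ennreal (m \<omega>)" "0 \<le> m \<omega>" "m \<omega> \<le> 1"
        by (auto simp: m_def D.emeasure_eq_measure)
    qed
    \<comment> \<open>The measure under the integral now no longer depends on
      \<open>\<omega>\<close>, so joint measurability of \<open>r\<close> gives measurability of the
      parametric integral.\<close>
    have "m \<in> borel_measurable P \<longleftrightarrow> (\<lambda>\<omega>. enn2real (\<integral>\<^sup>+ b. r (T \<omega>) b * indicator A b \<partial>MB)) \<in> borel_measurable P"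
      by (intro measurable_cong) (simp add: m_def measure_def em)
    then have [measurable]: "m \<in> borel_measurable P"
      by simp
    have int_m: "integrable P (\<lambda>\<omega>. indicat_real U \<omega> * m \<omega>)"
      by (rule integrable_const_bound[where B=1])
         (use m in \<open>auto intro!: AE_I2 split: split_indicator\<close>)
    have "emeasure M1 Z = emeasure P (U \<inter> V)"
      unfolding M1_def Z by (subst emeasure_distr) (auto simp: U_def V_def intro!: arg_cong[where f="emeasure P"])
    also have "\<dots> = ennreal (\<integral>\<omega>\<in>U. indicat_real V \<omega> \<partial>P)"
      by (simp add: set_lebesgue_integral_def indicator_inter_arith[symmetric] emeasure_eq_measure)
    \<comment> \<open>The defining property of conditional expectation applies since
      \<open>U\<close> is an event of \<open>G\<close>; here measurability of \<open>T\<close> with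
      respect to \<open>G\<close>, and not merely \<open>P\<close>, is essential.\<close>
    also have "(\<integral>\<omega>\<in>U. indicat_real V \<omega> \<partial>P) = (\<integral>\<omega>\<in>U. real_cond_exp P G (indicat_real V) \<omega> \<partial>P)"
      by (rule real_cond_exp_intA) (use U_G in \<open>auto simp: less_top[symmetric]\<close>)
    also have "\<dots> = (\<integral>\<omega>\<in>U. m \<omega> \<partial>P)"
      unfolding set_lebesgue_integral_def
    proof (rule integral_cong_AE)
      show "AE \<omega> in P. indicat_real U \<omega> *\<^sub>R real_cond_exp P G (indicat_real V) \<omega> = indicat_real U \<omega> *\<^sub>R m \<omega>"
        using law[OF \<open>A \<in> sets MB\<close>] by eventually_elim (simp add: V_def m_def)
    qed auto
    also have "ennreal (\<integral>\<omega>\<in>U. m \<omega> \<partial>P) = (\<integral>\<^sup>+ \<omega>. ennreal (indicat_real U \<omega> * m \<omega>) \<partial>P)"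
      unfolding set_lebesgue_integral_def
      by (subst nn_integral_eq_integral[OF int_m]) (use m in \<open>auto intro!: AE_I2 split: split_indicator\<close>)
    also have "\<dots> = (\<integral>\<^sup>+ \<omega>. \<integral>\<^sup>+ b. r (T \<omega>) b * (indicator B (T \<omega>) * indicator A b) \<partial>MB \<partial>P)"
    proof (rule nn_integral_cong)
      fix \<omega> assume \<omega>: "\<omega> \<in> space P"
      show "ennreal (indicat_real U \<omega> * m \<omega>) = (\<integral>\<^sup>+ b. r (T \<omega>) b * (indicator B (T \<omega>) * indicator A b) \<partial>MB)"
        using \<omega> by (cases "T \<omega> \<in> B") (simp_all add: U_def em'[symmetric] em)
    qed
    also have "\<dots> = integral\<^sup>N M2 (\<lambda>(t, b). indicator B t * indicator A b)"
      by (rule int2[symmetric]) measurable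
    also have "\<dots> = integral\<^sup>N M2 (indicator Z)"
      by (intro nn_integral_cong) (auto simp: Z indicator_def)
    also have "\<dots> = emeasure M2 Z"
      by (rule nn_integral_indicator) (simp add: Z M2_def sets_TB)
    finally show "emeasure M1 Z = emeasure M2 Z" .
  qed
  have "(\<integral>\<^sup>+ \<omega>. F (T \<omega>) (Y \<omega>) \<partial>P) = integral\<^sup>N M1 (\<lambda>(t, b). F t b)"
    unfolding M1_def by (subst nn_integral_distr) auto
  also have "\<dots> = (\<integral>\<^sup>+ \<omega>. \<integral>\<^sup>+ b. r (T \<omega>) b * F (T \<omega>) b \<partial>MB \<partial>P)"
    unfolding \<open>M1 = M2\<close> by (rule int2[OF F])
  also have "\<dots> = (\<integral>\<^sup>+ \<omega>. \<integral>\<^sup>+ b. F (T \<omega>) b \<partial>density MB (r (T \<omega>)) \<partial>P)"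
    using r_sec F_sec T_space by (intro nn_integral_cong nn_integral_density[symmetric]) auto
  finally show ?thesis .
qed

lemma sigma_finite_config_space:
  assumes "sigma_finite_measure \<nu>"
  shows "sigma_finite_measure (config_space \<nu> N)"
  using product_sigma_finite.sigma_finite[of "\<lambda>_. \<nu>" "{..<N}"] assms
  by (simp add: config_space_def product_sigma_finite_def)

lemma prob_space_born:
  assumes f: "f \<in> square_integrable Q" and nz: "\<not> (AE x in Q. f x = 0)"
  shows "prob_space (born Q f)" and "0 < (\<integral>y. (f y)\<^sup>2 \<partial>Q)"
proof -
  have [measurable]: "f \<in> borel_measurable Q" and i: "integrable Q (\<lambda>x. (f x)\<^sup>2)"
    using f by (auto simp: square_integrable_def)
  have "(\<integral>y. (f y)\<^sup>2 \<partial>Q) \<noteq> 0"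
    using nz integral_nonneg_eq_0_iff_AE[OF i] by simp
  then show pos: "0 < (\<integral>y. (f y)\<^sup>2 \<partial>Q)"
    by (simp add: less_le)
  show "prob_space (born Q f)"
  proof (rule prob_spaceI)
    have "emeasure (born Q f) (space (born Q f)) = (\<integral>\<^sup>+ x. ennreal ((f x)\<^sup>2 / (\<integral>y. (f y)\<^sup>2 \<partial>Q)) \<partial>Q)"
      by (simp add: born_def emeasure_density cong: nn_integral_cong)
    also have "\<dots> = ennreal (\<integral>x. (f x)\<^sup>2 / (\<integral>y. (f y)\<^sup>2 \<partial>Q) \<partial>Q)"
      using i pos by (intro nn_integral_eq_integral) auto
    also have "\<dots> = 1"
      using pos by simp
    finally show "emeasure (born Q f) (space (born Q f)) = 1" .
  qed
qed

lemma borel_measurable_vec_iff: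
  fixes f :: "'a \<Rightarrow> real^'n"
  shows "f \<in> borel_measurable M \<longleftrightarrow> (\<forall>i. (\<lambda>x. f x $ i) \<in> borel_measurable M)"
proof
  assume "f \<in> borel_measurable M"
  then have "(\<lambda>x. f x \<bullet> axis i 1) \<in> borel_measurable M" for i
    by simp
  then show "\<forall>i. (\<lambda>x. f x $ i) \<in> borel_measurable M"
    by (simp add: inner_axis)
next
  assume "\<forall>i. (\<lambda>x. f x $ i) \<in> borel_measurable M"
  then show "f \<in> borel_measurable M"
    by (subst borel_measurable_euclidean_space) (auto simp: Basis_vec_def inner_axis)
qed

text \<open>Since \<open>matrix_inv\<close> is given by choice, measurability is obtained from
  Cramer's rule: each component is a quotient of determinants, which are polynomials in the entries.
  \<open>?c k x\<close> is \<open>A x\<close> with column \<open>k\<close> replaced by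
  \<open>w x\<close>.\<close>

lemma borel_measurable_matrix_inv_mult_vec:
  fixes A :: "'a \<Rightarrow> real^'n^'n" and w :: "'a \<Rightarrow> real^'n"
  assumes inv: "\<And>x. x \<in> space M \<Longrightarrow> invertible (A x)"
    and A: "\<And>i j. (\<lambda>x. A x $ i $ j) \<in> borel_measurable M"
    and w: "\<And>i. (\<lambda>x. w x $ i) \<in> borel_measurable M"
  shows "(\<lambda>x. matrix_inv (A x) *v w x) \<in> borel_measurable M"
proof -
  let ?c = "\<lambda>k x. \<chi> i j. if j = k then w x $ i else A x $ i $ j"
  have det: "(\<lambda>x. det (B x)) \<in> borel_measurable M"
    if "\<And>i j. (\<lambda>x. B x $ i $ j) \<in> borel_measurable M" for B :: "'a \<Rightarrow> real^'n^'n"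
    unfolding det_def using that by (intro borel_measurable_sum borel_measurable_times borel_measurable_prod) auto
  have "(\<lambda>x. det (?c k x) / det (A x)) \<in> borel_measurable M" for k
    using A w by (intro borel_measurable_divide det) (auto intro!: measurable_If_set simp: if_distrib)
  moreover have "(matrix_inv (A x) *v w x) $ k = det (?c k x) / det (A x)" if "x \<in> space M" for x k
  proof -
    have "A x ** matrix_inv (A x) = mat 1"
      using inv[OF that] unfolding invertible_def matrix_inv_def by (rule someI2_ex) simp
    then have "A x *v (matrix_inv (A x) *v w x) = w x"
      by (simp add: matrix_vector_mul_assoc)
    moreover have "det (A x) \<noteq> 0"
      using inv[OF that] by (simp add: invertible_det_nz)
    ultimately show ?thesis
      by (simp add: cramer)
  qed
  ultimately show ?thesis
    unfolding borel_measurable_vec_iff by (simp cong: measurable_cong)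
qed

section \<open>The filtration generated by the batches\<close>

lemma measurable_batch:
  assumes "\<And>i. i < n \<Longrightarrow> X k i \<in> measurable P Q"
  shows "batch n X k \<in> measurable P (\<Pi>\<^sub>M i\<in>{..<n}. Q)"
  unfolding batch_def[abs_def] using assms by (intro measurable_restrict) auto

context
  fixes P :: "'w measure" and Q :: "'c measure" and n :: nat and X :: "nat \<Rightarrow> nat \<Rightarrow> 'w \<Rightarrow> 'c"
  assumes X: "\<And>k i. i < n \<Longrightarrow> X k i \<in> measurable P Q"
begin

lemma measurable_batches:
  "(\<lambda>\<omega>. \<lambda>j\<in>{..<k}. batch n X j \<omega>) \<in> measurable P (\<Pi>\<^sub>M j\<in>{..<k}. \<Pi>\<^sub>M i\<in>{..<n}. Q)"
  by (intro measurable_restrict measurable_batch X)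

lemma measurable_past_batch:
  assumes "j < k"
  shows "batch n X j \<in> measurable (past P Q n X k) (\<Pi>\<^sub>M i\<in>{..<n}. Q)"
proof -
  have "(\<lambda>\<omega>. \<lambda>j\<in>{..<k}. batch n X j \<omega>) \<in> measurable (past P Q n X k) (\<Pi>\<^sub>M j\<in>{..<k}. \<Pi>\<^sub>M i\<in>{..<n}. Q)"
    unfolding past_def
    by (rule measurable_vimage_algebra1) (rule Pi_I, rule measurable_space[OF measurable_batches])
  from measurable_compose[OF this measurable_component_singleton[of j]] show ?thesis
    using assms by simp
qed

lemma subalgebra_past: "subalgebra P (past P Q n X k)"
proof -
  have "(\<lambda>\<omega>. \<omega>) \<in> measurable P (past P Q n X k)"
    unfolding past_def
    by (rule measurable_vimage_algebra2) (auto intro: measurable_batches)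
  moreover have space: "space (past P Q n X k) = space P"
    by (simp add: past_def)
  ultimately have "A \<in> sets P" if "A \<in> sets (past P Q n X k)" for A
    using measurable_sets[OF _ that, of "\<lambda>\<omega>. \<omega>" P] sets.sets_into_space[OF that]
    by (simp add: Int_absorb2)
  with space show ?thesis
    by (auto simp: subalgebra_def)
qed

text \<open>Monotonicity of the filtration, expressed through the identity map: the first
  \<open>k\<close> batches are measurable for the later past, so the identity is measurable from the
  later past to the earlier one.\<close>

lemma measurable_past_Suc:
  assumes "f \<in> measurable (past P Q n X k) M"
  shows "f \<in> measurable (past P Q n X (Suc k)) M"
proof -
  have "(\<lambda>\<omega>. \<lambda>j\<in>{..<k}. batch n X j \<omega>) \<in> measurable (past P Q n X (Suc k)) (\<Pi>\<^sub>M j\<in>{..<k}. \<Pi>\<^sub>M i\<in>{..<n}. Q)"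
    by (intro measurable_restrict measurable_past_batch) simp
  moreover have "space (past P Q n X (Suc k)) = space P"
    by (simp add: past_def)
  ultimately have "(\<lambda>\<omega>. \<omega>) \<in> measurable (past P Q n X (Suc k)) (past P Q n X k)"
    unfolding past_def[of _ _ _ _ k] by (intro measurable_vimage_algebra2) auto
  from measurable_compose[OF this assms] show ?thesis .
qed

end

section \<open>Batch estimators and the expected gradient norm\<close>

lemma integrable_vec_componentwise:
  fixes f :: "'a \<Rightarrow> real^'n"
  assumes "\<And>j. integrable M (\<lambda>x. f x $ j)"
  shows "integrable M f" and "(\<integral>x. f x \<partial>M) $ j = (\<integral>x. f x $ j \<partial>M)"
proof -
  have "f = (\<lambda>x. \<Sum>j\<in>UNIV. (f x $ j) *\<^sub>R axis j 1)"
    by (simp add: fun_eq_iff vec_eq_iff axis_def if_distrib cong: if_cong)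
  moreover have "integrable M (\<lambda>x. \<Sum>j\<in>UNIV. (f x $ j) *\<^sub>R axis j (1::real))"
    by (intro Bochner_Integration.integrable_sum integrable_scaleR_left) (use assms in auto)
  ultimately show i: "integrable M f"
    by simp
  show "(\<integral>x. f x \<partial>M) $ j = (\<integral>x. f x $ j \<partial>M)"
    using integral_bounded_linear[OF bounded_linear_vec_nth i] by simp
qed

lemma batch_grad_nth:
  "batch_grad H \<psi> n t b $ j
     = 2 * sample_cov n (\<lambda>i. local_energy H \<psi> t (b i)) (\<lambda>i. log_grad \<psi> t (b i) $ j)"
  by (simp add: batch_grad_def sample_cov_def batch_centered_energy_def batch_energy_def
      batch_centered_log_grad_def)

lemma batch_S_nth:
  "batch_S \<psi> n t b $ r $ c
     = sample_cov n (\<lambda>i. log_grad \<psi> t (b i) $ r) (\<lambda>i. log_grad \<psi> t (b i) $ c)"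
  by (simp add: batch_S_def sample_cov_def batch_centered_log_grad_def outer_product_def)

text \<open>Measurability is required jointly in parameter and configuration because the estimators
  are evaluated at random parameters, namely the iterates.\<close>

locale vmc =
  fixes Q :: "'c measure" and H :: "('c \<Rightarrow> real) \<Rightarrow> 'c \<Rightarrow> real" and \<psi> :: "real^'p \<Rightarrow> 'c \<Rightarrow> real"
    and C_m C_g :: real
  assumes Q: "sigma_finite_measure Q"
    and psi_sq: "\<And>t. \<psi> t \<in> square_integrable Q"
    and psi_nonzero: "\<And>t. \<not> (AE x in Q. \<psi> t x = 0)"
    and psi_meas[measurable]: "(\<lambda>(t, x). \<psi> t x) \<in> borel_measurable (borel \<Otimes>\<^sub>M Q)"
    and Hpsi_meas[measurable]: "(\<lambda>(t, x). H (\<psi> t) x) \<in> borel_measurable (borel \<Otimes>\<^sub>M Q)"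
    and log_grad_meas[measurable]: "(\<lambda>(t, x). log_grad \<psi> t x) \<in> borel_measurable (borel \<Otimes>\<^sub>M Q)"
    and energy_diff: "\<And>t. energy Q H \<psi> differentiable (at t)"
    and vmc_identity:
      "\<And>t. energy_grad Q H \<psi> t =
         2 *\<^sub>R (\<integral>x. centered_energy Q H \<psi> t x *\<^sub>R centered_log_grad Q \<psi> t x \<partial>born Q (\<psi> t))"
    and C_m: "C_m > 0"
    and moment_log_grad:
      "\<And>t. (\<integral>\<^sup>+ x. ennreal (norm (log_grad \<psi> t x) ^ 4) \<partial>born Q (\<psi> t)) \<le> ennreal C_m"
    and moment_energy:
      "\<And>t. (\<integral>\<^sup>+ x. ennreal (local_energy H \<psi> t x ^ 4) \<partial>born Q (\<psi> t)) \<le> ennreal C_m"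
    and C_g: "C_g > 0"
    and lipschitz_grad:
      "\<And>t t'. norm (energy_grad Q H \<psi> t - energy_grad Q H \<psi> t') \<le> C_g * norm (t - t')"
begin

sublocale Q: sigma_finite_measure Q
  by (rule Q)

lemma local_energy_meas[measurable]:
  "(\<lambda>(t, x). local_energy H \<psi> t x) \<in> borel_measurable (borel \<Otimes>\<^sub>M Q)"
  unfolding local_energy_def[abs_def] by measurable

lemma log_grad_nth_meas[measurable]:
  "(\<lambda>(t, x). log_grad \<psi> t x $ j) \<in> borel_measurable (borel \<Otimes>\<^sub>M Q)"
  using log_grad_meas unfolding borel_measurable_vec_iff by (simp add: split_beta')

lemma section_meas:
  assumes "(\<lambda>(t, x). f t x) \<in> borel_measurable ((borel :: (real^'p) measure) \<Otimes>\<^sub>M Q)"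
  shows "f t \<in> borel_measurable Q"
  using measurable_compose[OF measurable_Pair1' assms, of t] by simp

lemma sets_born[measurable_cong]: "sets (born Q (\<psi> t)) = sets Q"
  by (simp add: born_def)

lemma born_prob: "prob_space (born Q (\<psi> t))"
  by (rule prob_space_born[OF psi_sq psi_nonzero])

lemma norm_sq_pos: "0 < (\<integral>y. (\<psi> t y)\<^sup>2 \<partial>Q)"
  by (rule prob_space_born[OF psi_sq psi_nonzero])

lemma integral_born:
  fixes f :: "'c \<Rightarrow> real"
  assumes "f \<in> borel_measurable Q"
  shows "(\<integral>x. f x \<partial>born Q (\<psi> t)) = (\<integral>x. ((\<psi> t x)\<^sup>2 / (\<integral>y. (\<psi> t y)\<^sup>2 \<partial>Q)) * f x \<partial>Q)"
proof -
  have [measurable]: "\<psi> t \<in> borel_measurable Q"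
    by (rule section_meas) simp
  show ?thesis
    unfolding born_def using norm_sq_pos[of t] by (subst integral_density[OF assms]) auto
qed

text \<open>Written over the fixed measure \<open>Q\<close>, the integral depends on
  \<open>t\<close> through its integrand only, and sigma-finiteness of \<open>Q\<close> makes such a
  parametric integral measurable.\<close>

lemma integral_born_measurable:
  fixes f :: "real^'p \<Rightarrow> 'c \<Rightarrow> real"
  assumes f[measurable]: "(\<lambda>(t, x). f t x) \<in> borel_measurable (borel \<Otimes>\<^sub>M Q)"
  shows "(\<lambda>t. \<integral>x. f t x \<partial>born Q (\<psi> t)) \<in> borel_measurable borel"
  unfolding integral_born[OF section_meas[OF f]] by measurable

lemma covariance_born_measurable:
  fixes a b :: "real^'p \<Rightarrow> 'c \<Rightarrow> real"
  assumes [measurable]: "(\<lambda>(t, x). a t x) \<in> borel_measurable (borel \<Otimes>\<^sub>M Q)"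
    "(\<lambda>(t, x). b t x) \<in> borel_measurable (borel \<Otimes>\<^sub>M Q)"
  shows "(\<lambda>t. covariance (born Q (\<psi> t)) (a t) (b t)) \<in> borel_measurable borel"
proof -
  note [measurable] = integral_born_measurable[OF assms(1)] integral_born_measurable[OF assms(2)]
  show ?thesis
    unfolding covariance_def by (rule integral_born_measurable) measurable
qed

lemma moment_log_grad_nth:
  "(\<integral>\<^sup>+ x. ennreal ((log_grad \<psi> t x $ j) ^ 4) \<partial>born Q (\<psi> t)) \<le> ennreal C_m"
proof -
  have "(v $ j) ^ 4 \<le> norm v ^ 4" for v :: "real^'p"
    using power_mono[OF component_le_norm_cart[of v j], of 4] by (simp add: power_abs abs_of_nonneg)
  then have "(\<integral>\<^sup>+ x. ennreal ((log_grad \<psi> t x $ j) ^ 4) \<partial>born Q (\<psi> t))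
      \<le> (\<integral>\<^sup>+ x. ennreal (norm (log_grad \<psi> t x) ^ 4) \<partial>born Q (\<psi> t))"
    by (intro nn_integral_mono ennreal_leI)
  also note moment_log_grad
  finally show ?thesis .
qed

lemma born_section_meas:
  "local_energy H \<psi> t \<in> borel_measurable (born Q (\<psi> t))"
  "(\<lambda>x. log_grad \<psi> t x $ j) \<in> borel_measurable (born Q (\<psi> t))"
  using section_meas[OF local_energy_meas] section_meas[OF log_grad_nth_meas]
  by (simp_all cong: measurable_cong_sets add: sets_born)

text \<open>Cancelling one factor \<open>\<psi> t x\<close> is valid even at its zeros: there the
  Born weight vanishes, and so does the product with \<open>H (\<psi> t) x\<close>.\<close>

lemma energy_eq: "energy Q H \<psi> t = (\<integral>x. local_energy H \<psi> t x \<partial>born Q (\<psi> t))"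
proof -
  have eq: "((\<psi> t x)\<^sup>2 / z) * local_energy H \<psi> t x = (\<psi> t x * H (\<psi> t) x) / z" for x z
    by (simp add: local_energy_def power2_eq_square)
  show ?thesis
    unfolding integral_born[OF section_meas[OF local_energy_meas]] eq
    by (simp add: energy_def l2_inner_def power2_eq_square)
qed

text \<open>Provides the constant \<open>B\<close> of the potential. By Jensen the fourth power of
  the energy is at most \<open>C_m\<close>.\<close>

lemma energy_lower_bound: "- (1 + C_m) \<le> energy Q H \<psi> t"
proof -
  interpret prob_space "born Q (\<psi> t)" by (rule born_prob)
  note E4 = fourth_moment_le[OF born_section_meas(1) moment_energy less_imp_le[OF C_m], of t]
  have "energy Q H \<psi> t ^ 4 \<le> C_m"
    using power_four_expectation_le(2)[OF born_section_meas(1) E4(1)] E4(2) by (simp add: energy_eq)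
  moreover have "- 1 - x ^ 4 \<le> x" for x :: real
  proof -
    \<comment> \<open>A sum-of-squares certificate: the right-hand side expands to
      \<open>x^4 + x + 1\<close>.\<close>
    have "0 \<le> (x\<^sup>2 - 1 / 2)\<^sup>2 + (x + 1 / 2)\<^sup>2 + 1 / 2"
      by (intro add_nonneg_nonneg) auto
    then show ?thesis
      by (simp add: power2_eq_square eval_nat_numeral algebra_simps)
  qed
  ultimately show ?thesis
    by (smt (verit))
qed

text \<open>The VMC identity read in coordinates. Both factors are centred at true Born means, by
  \<open>energy_eq\<close> for the energy, and the fourth moments make the products integrable, so
  the vector integral may be taken entrywise.\<close>

lemma energy_grad_nth:
  "energy_grad Q H \<psi> t $ j
     = 2 * covariance (born Q (\<psi> t)) (local_energy H \<psi> t) (\<lambda>x. log_grad \<psi> t x $ j)"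
proof -
  interpret prob_space "born Q (\<psi> t)" by (rule born_prob)
  note E4 = fourth_moment_le[OF born_section_meas(1) moment_energy less_imp_le[OF C_m], of t]
  note lg4 = fourth_moment_le[OF born_section_meas(2) moment_log_grad_nth less_imp_le[OF C_m], of t]
  note E = centered_fourth_moment(1)[OF born_section_meas(1) E4]
  note lg = centered_fourth_moment(1)[OF born_section_meas(2) lg4]
  have lg1: "integrable (born Q (\<psi> t)) (\<lambda>x. log_grad \<psi> t x $ i)" for i
    using integrable_lower_power[OF born_section_meas(2) lg4(1), of 1 i] by simp
  have comp: "(centered_energy Q H \<psi> t x *\<^sub>R centered_log_grad Q \<psi> t x) $ i
      = (local_energy H \<psi> t x - expectation (local_energy H \<psi> t))
        * (log_grad \<psi> t x $ i - expectation (\<lambda>y. log_grad \<psi> t y $ i))" for x i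
    by (simp add: centered_energy_def centered_log_grad_def energy_eq
        integrable_vec_componentwise(2)[OF lg1])
  have "integrable (born Q (\<psi> t)) (\<lambda>x. (centered_energy Q H \<psi> t x *\<^sub>R centered_log_grad Q \<psi> t x) $ i)" for i
    unfolding comp by (rule integrable_mult_fourth(2)[OF _ _ E lg]) (use born_section_meas in measurable)
  from integrable_vec_componentwise(2)[OF this, of j]
  have "(\<integral>x. centered_energy Q H \<psi> t x *\<^sub>R centered_log_grad Q \<psi> t x \<partial>born Q (\<psi> t)) $ j
      = covariance (born Q (\<psi> t)) (local_energy H \<psi> t) (\<lambda>x. log_grad \<psi> t x $ j)"
    unfolding comp covariance_def .
  then show ?thesis
    by (simp add: vmc_identity)
qed

lemmas energy_cov = sample_cov_mse[OF born_prob born_section_meas(1) born_section_meas(2) _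
    moment_energy moment_log_grad_nth less_imp_le[OF C_m]]

lemmas log_grad_cov = sample_cov_mse[OF born_prob born_section_meas(2) born_section_meas(2) _
    moment_log_grad_nth moment_log_grad_nth less_imp_le[OF C_m]]

lemma norm_energy_grad_le: "norm (energy_grad Q H \<psi> t) \<le> sqrt (64 * real CARD('p) * C_m)"
proof (rule real_le_rsqrt)
  have "(energy_grad Q H \<psi> t $ j)\<^sup>2 \<le> 64 * C_m" for j
    \<comment> \<open>\<open>order_refl\<close> merely selects sample size 2, since the covariance
      bound does not mention it. The constant 64 is 16 times the square of the factor 2 in the
      gradient.\<close>
    using energy_cov(2)[OF order_refl, of t j] by (simp add: energy_grad_nth power_mult_distrib)
  then have "(norm (energy_grad Q H \<psi> t))\<^sup>2 \<le> (\<Sum>j\<in>(UNIV::'p set). 64 * C_m)"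
    unfolding power2_norm_vec by (intro sum_mono)
  then show "(norm (energy_grad Q H \<psi> t))\<^sup>2 \<le> 64 * real CARD('p) * C_m"
    by simp
qed

text \<open>The population counterpart of \<open>batch_S\<close>; it takes the place of the bounded
  operator \<open>T\<close> in the pathwise bound.\<close>

definition mean_S :: "real^'p \<Rightarrow> real^'p^'p" where
  "mean_S t = (\<chi> r c. covariance (born Q (\<psi> t)) (\<lambda>x. log_grad \<psi> t x $ r) (\<lambda>x. log_grad \<psi> t x $ c))"

lemma norm_mean_S_le: "norm (mean_S t) \<le> sqrt (16 * (real CARD('p))\<^sup>2 * C_m)"
proof (rule real_le_rsqrt)
  have "(norm (mean_S t))\<^sup>2 \<le> (\<Sum>r\<in>(UNIV::'p set). \<Sum>c\<in>(UNIV::'p set). 16 * C_m)"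
    unfolding power2_norm_matrix using log_grad_cov(2)[OF order_refl]
    by (intro sum_mono) (simp add: mean_S_def)
  then show "(norm (mean_S t))\<^sup>2 \<le> 16 * (real CARD('p))\<^sup>2 * C_m"
    by (simp add: power2_eq_square)
qed

text \<open>Exactly the error term of the pathwise bound, with \<open>e k\<close> taken as the
  Frobenius distance of the matrices. The Frobenius norm dominates the operator norm and splits into
  scalar squared errors.\<close>

definition batch_error :: "nat \<Rightarrow> real^'p \<Rightarrow> (nat \<Rightarrow> 'c) \<Rightarrow> real" where
  "batch_error n t b = (norm (batch_grad H \<psi> n t b - energy_grad Q H \<psi> t))\<^sup>2
     + (norm (batch_S \<psi> n t b - mean_S t))\<^sup>2"

lemma batch_error_eq:
  "batch_error n t b = (\<Sum>j\<in>UNIV. 4 * (sample_cov n (\<lambda>i. local_energy H \<psi> t (b i)) (\<lambda>i. log_grad \<psi> t (b i) $ j)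
         - covariance (born Q (\<psi> t)) (local_energy H \<psi> t) (\<lambda>x. log_grad \<psi> t x $ j))\<^sup>2)
     + (\<Sum>r\<in>UNIV. \<Sum>c\<in>UNIV. (sample_cov n (\<lambda>i. log_grad \<psi> t (b i) $ r) (\<lambda>i. log_grad \<psi> t (b i) $ c)
         - covariance (born Q (\<psi> t)) (\<lambda>x. log_grad \<psi> t x $ r) (\<lambda>x. log_grad \<psi> t x $ c))\<^sup>2)"
proof -
  have "(2 * x - 2 * y)\<^sup>2 = 4 * (x - y)\<^sup>2" for x y :: real
    by (simp add: power2_eq_square algebra_simps)
  then show ?thesis
    by (simp add: batch_error_def power2_norm_vec power2_norm_matrix batch_grad_nth energy_grad_nth
        batch_S_nth mean_S_def)
qed

lemma batch_component_meas:
  fixes a :: "real^'p \<Rightarrow> 'c \<Rightarrow> real"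
  assumes "(\<lambda>(t, x). a t x) \<in> borel_measurable (borel \<Otimes>\<^sub>M Q)" and i: "i < n"
  shows "(\<lambda>(t, b). a t (b i)) \<in> borel_measurable (borel \<Otimes>\<^sub>M (\<Pi>\<^sub>M i\<in>{..<n}. Q))"
proof -
  have [measurable]: "(\<lambda>b. b i) \<in> measurable (\<Pi>\<^sub>M i\<in>{..<n}. Q) Q"
    using i by (intro measurable_component_singleton) simp
  have "(\<lambda>(t, b). (t, b i)) \<in> measurable ((borel :: (real^'p) measure) \<Otimes>\<^sub>M (\<Pi>\<^sub>M i\<in>{..<n}. Q)) (borel \<Otimes>\<^sub>M Q)"
    by measurable
  from measurable_compose[OF this assms(1)] show ?thesis
    by (simp add: split_beta')
qed

lemma sample_cov_meas:
  fixes u v :: "'d \<Rightarrow> nat \<Rightarrow> real"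
  assumes "\<And>i. i < n \<Longrightarrow> (\<lambda>x. u x i) \<in> borel_measurable M" "\<And>i. i < n \<Longrightarrow> (\<lambda>x. v x i) \<in> borel_measurable M"
  shows "(\<lambda>x. sample_cov n (u x) (v x)) \<in> borel_measurable M"
  unfolding sample_cov_def using assms
  by (intro borel_measurable_times borel_measurable_sum borel_measurable_diff) auto

lemma batch_sample_cov_meas:
  fixes a c :: "real^'p \<Rightarrow> 'c \<Rightarrow> real"
  assumes "(\<lambda>(t, x). a t x) \<in> borel_measurable (borel \<Otimes>\<^sub>M Q)"
    "(\<lambda>(t, x). c t x) \<in> borel_measurable (borel \<Otimes>\<^sub>M Q)"
  shows "(\<lambda>(t, b). sample_cov n (\<lambda>i. a t (b i)) (\<lambda>i. c t (b i))) \<in> borel_measurable (borel \<Otimes>\<^sub>M (\<Pi>\<^sub>M i\<in>{..<n}. Q))"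
  unfolding split_beta' using batch_component_meas[OF assms(1), unfolded split_beta'] batch_component_meas[OF assms(2), unfolded split_beta']
  by (intro sample_cov_meas) auto

lemma batch_error_meas:
  "(\<lambda>(t, b). batch_error n t b) \<in> borel_measurable (borel \<Otimes>\<^sub>M (\<Pi>\<^sub>M i\<in>{..<n}. Q))"
proof -
  have fst_meas: "(\<lambda>x. f (fst x)) \<in> borel_measurable (borel \<Otimes>\<^sub>M (\<Pi>\<^sub>M i\<in>{..<n}. Q))"
    if "f \<in> borel_measurable borel" for f :: "real^'p \<Rightarrow> real"
    using measurable_compose[OF measurable_fst that] .
  show ?thesis
    unfolding batch_error_eq split_beta'
    by (intro borel_measurable_add borel_measurable_sum borel_measurable_times borel_measurable_power
        borel_measurable_diff borel_measurable_const fst_meas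
        batch_sample_cov_meas[unfolded split_beta'] covariance_born_measurable
        local_energy_meas log_grad_nth_meas local_energy_meas[unfolded split_beta'] log_grad_nth_meas[unfolded split_beta'])
qed

text \<open>Each scalar squared error costs \<open>960 * C_m / n\<close>: the gradient has one per
  coordinate, weighted by 4, and the matrix has one per entry.\<close>

lemma batch_error_mean:
  assumes n: "n \<ge> 2"
  shows "(\<integral>\<^sup>+ b. ennreal (batch_error n t b) \<partial>(\<Pi>\<^sub>M i\<in>{..<n}. born Q (\<psi> t)))
     \<le> ennreal ((4 * real CARD('p) + (real CARD('p))\<^sup>2) * (960 * C_m) / real n)"
proof -
  let ?P = "\<Pi>\<^sub>M i\<in>{..<n}. born Q (\<psi> t)"
  have meas[measurable]: "(\<lambda>b. sample_cov n (\<lambda>i. a (b i)) (\<lambda>i. c (b i))) \<in> borel_measurable ?P"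
    if [measurable]: "a \<in> borel_measurable (born Q (\<psi> t))" "c \<in> borel_measurable (born Q (\<psi> t))" for a c
    by (intro sample_cov_meas) (use that in measurable)
  note [measurable] = born_section_meas
  let ?B = "ennreal (960 * C_m / real n)"
  let ?e = "\<lambda>j b. (sample_cov n (\<lambda>i. local_energy H \<psi> t (b i)) (\<lambda>i. log_grad \<psi> t (b i) $ j)
         - covariance (born Q (\<psi> t)) (local_energy H \<psi> t) (\<lambda>x. log_grad \<psi> t x $ j))\<^sup>2"
  let ?s = "\<lambda>r c b. (sample_cov n (\<lambda>i. log_grad \<psi> t (b i) $ r) (\<lambda>i. log_grad \<psi> t (b i) $ c)
         - covariance (born Q (\<psi> t)) (\<lambda>x. log_grad \<psi> t x $ r) (\<lambda>x. log_grad \<psi> t x $ c))\<^sup>2"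
  have "(\<integral>\<^sup>+ b. ennreal (batch_error n t b) \<partial>?P)
      = (\<integral>\<^sup>+ b. (\<Sum>j\<in>UNIV. 4 * ennreal (?e j b)) + (\<Sum>r\<in>UNIV. \<Sum>c\<in>UNIV. ennreal (?s r c b)) \<partial>?P)"
    unfolding batch_error_eq
    by (intro nn_integral_cong) (simp add: ennreal_plus sum_nonneg ennreal_mult' sum_ennreal[symmetric] del: sum_ennreal)
  also have "\<dots> = (\<Sum>j\<in>UNIV. 4 * (\<integral>\<^sup>+ b. ennreal (?e j b) \<partial>?P)) + (\<Sum>r\<in>UNIV. \<Sum>c\<in>UNIV. \<integral>\<^sup>+ b. ennreal (?s r c b) \<partial>?P)"
    by (simp add: nn_integral_add nn_integral_sum nn_integral_cmult del: sum_ennreal)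
  also have "\<dots> \<le> (\<Sum>j\<in>(UNIV::'p set). 4 * ?B) + (\<Sum>r\<in>(UNIV::'p set). \<Sum>c\<in>(UNIV::'p set). ?B)"
    by (intro add_mono sum_mono mult_left_mono energy_cov(1)[OF n] log_grad_cov(1)[OF n]) auto
  also have "\<dots> = ennreal ((4 * real CARD('p) + (real CARD('p))\<^sup>2) * (960 * C_m) / real n)"
  proof -
    have "4 * ?B = ennreal (4 * (960 * C_m / real n))"
      using C_m by (subst ennreal_mult') auto
    then show ?thesis
      using C_m n by (simp add: sum_ennreal ennreal_of_nat_eq_real_of_nat ennreal_mult'[symmetric] ennreal_plus[symmetric]
          power2_eq_square field_simps del: ennreal_plus)
  qed
  finally show ?thesis .
qed


section \<open>Adaptedness of the iterates and expected error along a run\<close>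

lemma spring_run_step:
  assumes run: "spring_run Q H \<psi> lam \<mu> \<eta> \<theta>init \<Delta>init n P X \<theta> \<Delta>"
    and "\<omega> \<in> space P" and lam: "lam > 0" and n: "n \<ge> 2"
  shows "lam *\<^sub>R \<Delta> (Suc k) \<omega> + batch_S \<psi> n (\<theta> k \<omega>) (batch n X k \<omega>) *v \<Delta> (Suc k) \<omega>
      = (lam * \<mu>) *\<^sub>R \<Delta> k \<omega> - (1/2) *\<^sub>R batch_grad H \<psi> n (\<theta> k \<omega>) (batch n X k \<omega>)"
    and "\<theta> (Suc k) \<omega> = \<theta> k \<omega> + \<eta> k *\<^sub>R \<Delta> (Suc k) \<omega>"
proof -
  have inv: "invertible (lam *\<^sub>R mat 1 + batch_S \<psi> n t b)" for t b
    by (rule invertible_shifted_psd[OF lam batch_S_psd[OF n]])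
  have "matrix_inv (lam *\<^sub>R mat 1 + batch_S \<psi> n (\<theta> k \<omega>) (batch n X k \<omega>)) *v
            ((lam * \<mu>) *\<^sub>R \<Delta> k \<omega> - (1/2) *\<^sub>R batch_grad H \<psi> n (\<theta> k \<omega>) (batch n X k \<omega>)) = \<Delta> (Suc k) \<omega>"
    using run \<open>\<omega> \<in> space P\<close> by (simp add: spring_run_def)
  then show "lam *\<^sub>R \<Delta> (Suc k) \<omega> + batch_S \<psi> n (\<theta> k \<omega>) (batch n X k \<omega>) *v \<Delta> (Suc k) \<omega>
      = (lam * \<mu>) *\<^sub>R \<Delta> k \<omega> - (1/2) *\<^sub>R batch_grad H \<psi> n (\<theta> k \<omega>) (batch n X k \<omega>)"
    unfolding matrix_inv_mult_vec_eq_iff[OF inv]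
    by (simp add: matrix_vector_mult_add_rdistrib scaleR_matrix_vector_assoc[symmetric])
  show "\<theta> (Suc k) \<omega> = \<theta> k \<omega> + \<eta> k *\<^sub>R \<Delta> (Suc k) \<omega>"
    using run \<open>\<omega> \<in> space P\<close> by (simp add: spring_run_def)
qed

text \<open>The conditional law can be evaluated at the current iterate only if that iterate is
  known given the earlier batches. Owing to the index shift, \<open>\<theta> k\<close> and
  \<open>\<Delta> k\<close> both use the batches below \<open>k\<close> only; they are treated
  together because each update involves both.\<close>

lemma spring_iterates_measurable_past:
  assumes run: "spring_run Q H \<psi> lam \<mu> \<eta> \<theta>init \<Delta>init n P X \<theta> \<Delta>"
    and lam: "lam > 0" and n: "n \<ge> 2"
  shows "\<theta> k \<in> borel_measurable (past P Q n X k)" and "\<Delta> k \<in> borel_measurable (past P Q n X k)"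
proof -
  have X: "\<And>k i. i < n \<Longrightarrow> X k i \<in> measurable P Q"
    using run by (auto simp: spring_run_def)
  have space: "space (past P Q n X k) = space P" for k
    by (simp add: past_def)
  have "\<theta> k \<in> borel_measurable (past P Q n X k) \<and> \<Delta> k \<in> borel_measurable (past P Q n X k)"
  proof (induction k)
    case 0
    have "\<theta> 0 \<in> borel_measurable (past P Q n X 0) \<longleftrightarrow> (\<lambda>_. \<theta>init) \<in> borel_measurable (past P Q n X 0)"
      "\<Delta> 0 \<in> borel_measurable (past P Q n X 0) \<longleftrightarrow> (\<lambda>_. \<Delta>init) \<in> borel_measurable (past P Q n X 0)"
      by (intro measurable_cong; use run in \<open>simp add: spring_run_def space\<close>)+
    then show ?case
      by simp
  next
    case (Suc k)
    let ?G = "past P Q n X (Suc k)"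
    have t: "\<theta> k \<in> borel_measurable ?G" and d: "\<Delta> k \<in> borel_measurable ?G"
      using Suc measurable_past_Suc[of n X P Q, OF X] by blast+
    have b: "batch n X k \<in> measurable ?G (\<Pi>\<^sub>M i\<in>{..<n}. Q)"
      by (rule measurable_past_batch[of n X P Q, OF X]) auto
    have tb: "(\<lambda>\<omega>. (\<theta> k \<omega>, batch n X k \<omega>)) \<in> measurable ?G (borel \<Otimes>\<^sub>M (\<Pi>\<^sub>M i\<in>{..<n}. Q))"
      using t b by measurable
    have S: "(\<lambda>\<omega>. batch_S \<psi> n (\<theta> k \<omega>) (batch n X k \<omega>) $ r $ c) \<in> borel_measurable ?G" for r c
      using measurable_compose[OF tb batch_sample_cov_meas[OF log_grad_nth_meas log_grad_nth_meas]]
      by (simp add: batch_S_nth)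
    have g: "(\<lambda>\<omega>. batch_grad H \<psi> n (\<theta> k \<omega>) (batch n X k \<omega>) $ j) \<in> borel_measurable ?G" for j
      using measurable_compose[OF tb batch_sample_cov_meas[OF local_energy_meas log_grad_nth_meas]]
      by (simp add: batch_grad_nth)
    have dj: "(\<lambda>\<omega>. \<Delta> k \<omega> $ j) \<in> borel_measurable ?G" for j
      using d by (simp add: borel_measurable_vec_iff)
    have "(\<lambda>\<omega>. matrix_inv (lam *\<^sub>R mat 1 + batch_S \<psi> n (\<theta> k \<omega>) (batch n X k \<omega>)) *v
            ((lam * \<mu>) *\<^sub>R \<Delta> k \<omega> - (1/2) *\<^sub>R batch_grad H \<psi> n (\<theta> k \<omega>) (batch n X k \<omega>)))
        \<in> borel_measurable ?G"
    proof (rule borel_measurable_matrix_inv_mult_vec)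
      show "invertible (lam *\<^sub>R mat 1 + batch_S \<psi> n (\<theta> k \<omega>) (batch n X k \<omega>))" for \<omega>
        by (rule invertible_shifted_psd[OF lam batch_S_psd[OF n]])
    qed (use S g dj in simp_all)
    moreover have "\<Delta> (Suc k) \<in> borel_measurable ?G \<longleftrightarrow>
        (\<lambda>\<omega>. matrix_inv (lam *\<^sub>R mat 1 + batch_S \<psi> n (\<theta> k \<omega>) (batch n X k \<omega>)) *v
            ((lam * \<mu>) *\<^sub>R \<Delta> k \<omega> - (1/2) *\<^sub>R batch_grad H \<psi> n (\<theta> k \<omega>) (batch n X k \<omega>)))
        \<in> borel_measurable ?G"
      by (intro measurable_cong) (use run in \<open>simp add: spring_run_def space\<close>)
    ultimately have d': "\<Delta> (Suc k) \<in> borel_measurable ?G"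
      by blast
    have "\<theta> (Suc k) \<in> borel_measurable ?G \<longleftrightarrow> (\<lambda>\<omega>. \<theta> k \<omega> + \<eta> k *\<^sub>R \<Delta> (Suc k) \<omega>) \<in> borel_measurable ?G"
      by (intro measurable_cong) (use run in \<open>simp add: spring_run_def space\<close>)
    then have "\<theta> (Suc k) \<in> borel_measurable ?G"
      using t d' by simp
    with d' show ?case
      by simp
  qed
  then show "\<theta> k \<in> borel_measurable (past P Q n X k)" and "\<Delta> k \<in> borel_measurable (past P Q n X k)"
    by auto
qed

lemma expected_batch_error:
  assumes run: "spring_run Q H \<psi> lam \<mu> \<eta> \<theta>init \<Delta>init n P X \<theta> \<Delta>"
    and lam: "lam > 0" and n: "n \<ge> 2"
  shows "(\<integral>\<^sup>+ \<omega>. ennreal (batch_error n (\<theta> k \<omega>) (batch n X k \<omega>)) \<partial>P)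
     \<le> ennreal ((4 * real CARD('p) + (real CARD('p))\<^sup>2) * (960 * C_m) / real n)"
    and "(\<lambda>\<omega>. batch_error n (\<theta> k \<omega>) (batch n X k \<omega>)) \<in> borel_measurable P"
    and "\<theta> k \<in> borel_measurable P"
proof -
  have X: "\<And>k i. i < n \<Longrightarrow> X k i \<in> measurable P Q" and P: "prob_space P"
    and law: "\<And>A. A \<in> sets (\<Pi>\<^sub>M i\<in>{..<n}. Q) \<Longrightarrow> AE \<omega> in P.
        real_cond_exp P (past P Q n X k) (indicat_real {\<omega> \<in> space P. batch n X k \<omega> \<in> A}) \<omega> =
          measure (\<Pi>\<^sub>M i\<in>{..<n}. born Q (\<psi> (\<theta> k \<omega>))) A"
    using run by (auto simp: spring_run_def)
  interpret P: prob_space P by (rule P)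
  interpret QP: product_sigma_finite "\<lambda>_. Q"
    by (simp add: product_sigma_finite_def Q)
  have QP: "sigma_finite_measure (\<Pi>\<^sub>M i\<in>{..<n}. Q)"
    by (rule QP.sigma_finite) simp
  note sub = subalgebra_past[of n X P Q k, OF X]
  note t_past = spring_iterates_measurable_past(1)[OF run lam n, of k]
  show t: "\<theta> k \<in> borel_measurable P"
    by (rule measurable_from_subalg[OF sub t_past])
  have b: "batch n X k \<in> measurable P (\<Pi>\<^sub>M i\<in>{..<n}. Q)"
    by (rule measurable_batch[OF X])
  have tb: "(\<lambda>\<omega>. (\<theta> k \<omega>, batch n X k \<omega>)) \<in> measurable P (borel \<Otimes>\<^sub>M (\<Pi>\<^sub>M i\<in>{..<n}. Q))"
    using t b by measurable
  show "(\<lambda>\<omega>. batch_error n (\<theta> k \<omega>) (batch n X k \<omega>)) \<in> borel_measurable P"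
    using measurable_compose[OF tb batch_error_meas] by simp
  \<comment> \<open>The likelihood of a batch under the Born law at \<open>t\<close>, relative to
    the product of \<open>Q\<close>.\<close>
  define r where "r t b = (\<Prod>i<n. ennreal ((\<psi> t (b i))\<^sup>2 / (\<integral>y. (\<psi> t y)\<^sup>2 \<partial>Q)))" for t b
  have dens: "density (\<Pi>\<^sub>M i\<in>{..<n}. Q) (r t) = (\<Pi>\<^sub>M i\<in>{..<n}. born Q (\<psi> t))" for t
  proof -
    have [measurable]: "\<psi> t \<in> borel_measurable Q"
      by (rule section_meas) simp
    have "sigma_finite_measure (born Q (\<psi> t))"
      using born_prob by (rule prob_space_imp_sigma_finite)
    then show ?thesis
      unfolding r_def[abs_def] born_def by (intro PiM_density[symmetric] Q) auto
  qed
  have r_meas: "(\<lambda>(t, b). r t b) \<in> borel_measurable (borel \<Otimes>\<^sub>M (\<Pi>\<^sub>M i\<in>{..<n}. Q))"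
  proof -
    have "(\<lambda>(t, x). (\<psi> t x)\<^sup>2 / (\<integral>y. (\<psi> t y)\<^sup>2 \<partial>Q)) \<in> borel_measurable (borel \<Otimes>\<^sub>M Q)"
      by measurable
    from batch_component_meas[OF this, unfolded split_beta'] show ?thesis
      unfolding r_def split_beta' by (intro borel_measurable_prod_ennreal measurable_compose[OF _ measurable_ennreal]) auto
  qed
  have "(\<integral>\<^sup>+ \<omega>. ennreal (batch_error n (\<theta> k \<omega>) (batch n X k \<omega>)) \<partial>P)
      = (\<integral>\<^sup>+ \<omega>. \<integral>\<^sup>+ b. ennreal (batch_error n (\<theta> k \<omega>) b) \<partial>density (\<Pi>\<^sub>M i\<in>{..<n}. Q) (r (\<theta> k \<omega>)) \<partial>P)"
  proof (rule nn_integral_conditional_density[OF P sub t_past b QP r_meas])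
    show "prob_space (density (\<Pi>\<^sub>M i\<in>{..<n}. Q) (r t))" for t
      unfolding dens by (rule prob_space_PiM) (rule born_prob)
    show "(\<lambda>(t, b). ennreal (batch_error n t b)) \<in> borel_measurable (borel \<Otimes>\<^sub>M (\<Pi>\<^sub>M i\<in>{..<n}. Q))"
      using measurable_compose[OF batch_error_meas measurable_ennreal] by (simp add: split_beta')
    show "AE \<omega> in P. real_cond_exp P (past P Q n X k) (indicat_real {\<omega> \<in> space P. batch n X k \<omega> \<in> A}) \<omega> =
          measure (density (\<Pi>\<^sub>M i\<in>{..<n}. Q) (r (\<theta> k \<omega>))) A" if "A \<in> sets (\<Pi>\<^sub>M i\<in>{..<n}. Q)" for A
      using law[OF that] unfolding dens .
  qed
  also have "\<dots> \<le> (\<integral>\<^sup>+ \<omega>. ennreal ((4 * real CARD('p) + (real CARD('p))\<^sup>2) * (960 * C_m) / real n) \<partial>P)"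
    unfolding dens by (intro nn_integral_mono batch_error_mean n)
  finally show "(\<integral>\<^sup>+ \<omega>. ennreal (batch_error n (\<theta> k \<omega>) (batch n X k \<omega>)) \<partial>P)
     \<le> ennreal ((4 * real CARD('p) + (real CARD('p))\<^sup>2) * (960 * C_m) / real n)"
    by (simp add: P.emeasure_space_1)
qed

section \<open>Convergence of the expected squared gradient norm\<close>

lemma energy_descent:
  "energy Q H \<psi> (x + v) \<le> energy Q H \<psi> x + energy_grad Q H \<psi> x \<bullet> v + C_g / 2 * (norm v)\<^sup>2"
proof (rule lipschitz_gradient_descent)
  show "GDERIV (energy Q H \<psi>) x :> energy_grad Q H \<psi> x" for x
    unfolding energy_grad_def by (rule differentiable_imp_gderiv[OF energy_diff])
qed (rule lipschitz_grad)

lemma energy_grad_meas: "energy_grad Q H \<psi> \<in> borel_measurable borel"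
proof (rule borel_measurable_continuous_onI)
  have "C_g-lipschitz_on UNIV (energy_grad Q H \<psi>)"
    using lipschitz_grad C_g by (intro lipschitz_onI) (auto simp: dist_norm)
  then show "continuous_on UNIV (energy_grad Q H \<psi>)"
    by (rule lipschitz_on_continuous_on)
qed

text \<open>A minimum is at most any weighted average, here with weights \<open>\<eta> k\<close>;
  taking expectations in the pathwise bound and dividing by the total weight gives the rate.\<close>

theorem spring_convergence:
  assumes lam: "lam > 0" and \<mu>: "0 \<le> \<mu>" "\<mu> < 1"
    and \<eta>: "\<And>k. 0 < \<eta> k" "\<And>k. \<eta> (Suc k) \<le> \<eta> k" "\<eta> 0 \<le> 2 * lam * (1 - \<mu>) / C_g"
  shows "\<exists>C>0. \<forall>n\<ge>2. \<forall>(P :: 'w measure) X \<theta> \<Delta>.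
           spring_run Q H \<psi> lam \<mu> \<eta> \<theta>init \<Delta>init n P X \<theta> \<Delta> \<longrightarrow>
           (\<forall>K\<ge>1. (MIN k\<in>{1..K}. \<integral>\<^sup>+ \<omega>. ennreal ((norm (energy_grad Q H \<psi> (\<theta> k \<omega>)))\<^sup>2) \<partial>P)
                    \<le> ennreal (C * (1 / (\<Sum>k=1..K. \<eta> k) + 1 / real n)))"
proof -
  define p where "p = real CARD('p)"
  define G where "G = sqrt (64 * p * C_m)"
  define s where "s = sqrt (16 * p\<^sup>2 * C_m)"
  define c where "c = lam * (1 - \<mu>)"
  define A where "A = 3 * (4 * lam\<^sup>2 + (2 * lam + 2 * s)\<^sup>2 + 1) + 2 * G"
  define \<Phi> where "\<Phi> = energy Q H \<psi> \<theta>init + (1 + C_m) + lam * \<mu> * \<eta> 0 * (norm \<Delta>init)\<^sup>2"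
  define A0 where "A0 = 4 * A / c * \<Phi>"
  define A1 where "A1 = A * (2 / c\<^sup>2 + 1)"
  define V where "V = (4 * p + p\<^sup>2) * (960 * C_m)"
  \<comment> \<open>The first two summands serve the inverse step-size sum and the third serves
    \<open>1 / n\<close>; the final 1 ensures strict positivity. Only the dimension, the problem
    constants, \<open>\<eta> 0\<close> and the initial data enter.\<close>
  define C where "C = A0 + A1 * V * \<eta> 0 + A1 * V + 1"
  have \<eta>0: "0 \<le> \<eta> k" for k
    using \<eta>(1)[of k] by simp
  have pos: "0 \<le> G" "0 \<le> s" "0 < c" "0 \<le> V"
    using C_m lam \<mu> by (auto simp: G_def s_def c_def V_def p_def)
  then have A: "0 \<le> A" "0 \<le> A1"
    by (auto simp: A_def A1_def)
  have "0 \<le> \<Phi>"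
    using energy_lower_bound[of \<theta>init] lam \<mu> \<eta>0 by (simp add: \<Phi>_def)
  with A pos have A0: "0 \<le> A0"
    by (simp add: A0_def)
  have "0 < C"
    using A0 A pos \<eta>0 by (simp add: C_def add_nonneg_pos)
  moreover have "(MIN k\<in>{1..K}. \<integral>\<^sup>+ \<omega>. ennreal ((norm (energy_grad Q H \<psi> (\<theta> k \<omega>)))\<^sup>2) \<partial>P)
      \<le> ennreal (C * (1 / (\<Sum>k=1..K. \<eta> k) + 1 / real n))"
    if n: "n \<ge> 2" and run: "spring_run Q H \<psi> lam \<mu> \<eta> \<theta>init \<Delta>init n P X \<theta> \<Delta>" and K: "K \<ge> 1"
    for n and P :: "'w measure" and X \<theta> \<Delta> K
  proof -
    interpret P: prob_space P
      using run by (simp add: spring_run_def)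
    define g where "g k \<omega> = (norm (energy_grad Q H \<psi> (\<theta> k \<omega>)))\<^sup>2" for k \<omega>
    define E where "E k \<omega> = batch_error n (\<theta> k \<omega>) (batch n X k \<omega>)" for k \<omega>
    define m where "m = (MIN k\<in>{1..K}. \<integral>\<^sup>+ \<omega>. ennreal (g k \<omega>) \<partial>P)"
    define \<sigma> where "\<sigma> = (\<Sum>k=1..K. \<eta> k)"
    note err = expected_batch_error[OF run lam n]
    have [measurable]: "g k \<in> borel_measurable P" for k
      using measurable_compose[OF err(3) energy_grad_meas] by (simp add: g_def[abs_def])
    have [measurable]: "E k \<in> borel_measurable P" for k
      using err(2) by (simp add: E_def[abs_def])
    have g0: "0 \<le> g k \<omega>" for k \<omega>
      by (simp add: g_def)
    have E0: "0 \<le> E k \<omega>" for k \<omega>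
      by (simp add: E_def batch_error_def)
    have path: "(\<Sum>k=1..K. \<eta> k * g k \<omega>) \<le> A0 + A1 * (\<Sum>k\<le>K. \<eta> k * E k \<omega>)" if "\<omega> \<in> space P" for \<omega>
    proof -
      let ?S = "\<lambda>k. batch_S \<psi> n (\<theta> k \<omega>) (batch n X k \<omega>)"
      have "\<theta> 0 \<omega> = \<theta>init" "\<Delta> 0 \<omega> = \<Delta>init"
        using run that by (auto simp: spring_run_def)
      moreover have "(\<Sum>k=1..K. \<eta> k * (norm (energy_grad Q H \<psi> (\<theta> k \<omega>)))\<^sup>2)
         \<le> 4 * A / c * (energy Q H \<psi> (\<theta> 0 \<omega>) + (1 + C_m) + lam * \<mu> * \<eta> 0 * (norm (\<Delta> 0 \<omega>))\<^sup>2)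
           + A * (2 / c\<^sup>2 + 1) * (\<Sum>k\<le>K. \<eta> k * ((norm (batch_grad H \<psi> n (\<theta> k \<omega>) (batch n X k \<omega>) - energy_grad Q H \<psi> (\<theta> k \<omega>)))\<^sup>2
             + (norm (?S k - mean_S (\<theta> k \<omega>)))\<^sup>2))"
        unfolding A_def c_def
      proof (rule spring_pathwise_bound[where S="\<lambda>k v. ?S k *v v" and T="\<lambda>k v. mean_S (\<theta> k \<omega>) *v v"
            and D="\<lambda>k. \<Delta> k \<omega>" and x="\<lambda>k. \<theta> k \<omega>" and g="energy_grad Q H \<psi>" and Cg=C_g])
        show "norm (energy_grad Q H \<psi> x) \<le> G" for x
          unfolding G_def p_def by (rule norm_energy_grad_le)
        show "norm (mean_S (\<theta> k \<omega>) *v v) \<le> s * norm v" for k v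
          using norm_mean_S_le[of "\<theta> k \<omega>"]
          by (intro order_trans[OF norm_matrix_vector_le] mult_right_mono) (auto simp: s_def p_def)
        show "norm (?S k *v v - mean_S (\<theta> k \<omega>) *v v) \<le> norm (?S k - mean_S (\<theta> k \<omega>)) * norm v" for k v
          using norm_matrix_vector_le[of "?S k - mean_S (\<theta> k \<omega>)" v] by (simp add: matrix_vector_mult_diff_rdistrib)
      qed (use energy_descent energy_lower_bound spring_run_step[OF run that lam n] batch_S_psd[OF n] lam \<mu> C_g pos \<eta> in auto)
      ultimately show ?thesis
        by (simp add: g_def E_def batch_error_def A0_def A1_def \<Phi>_def)
    qed
    have "\<eta> 1 \<le> \<sigma>"
      unfolding \<sigma>_def using K \<eta>0 by (intro member_le_sum) auto
    then have \<sigma>: "0 < \<sigma>"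
      using \<eta>(1)[of 1] by linarith
    \<comment> \<open>The errors are summed from index 0 but the gradients from index 1. The surplus
      \<open>\<eta> 0\<close>, divided by \<open>\<sigma>\<close>, is later charged to the
      \<open>1 / \<sigma>\<close> term.\<close>
    have "(\<Sum>k\<le>K. \<eta> k) = \<eta> 0 + \<sigma>"
      unfolding \<sigma>_def by (simp add: sum.atMost_shift atMost_atLeast0 sum.atLeast_Suc_atMost)
    note sum_\<eta> = this
    have "ennreal \<sigma> * m = (\<Sum>k=1..K. ennreal (\<eta> k) * m)"
      using \<eta>0 by (simp add: \<sigma>_def sum_ennreal[symmetric] sum_distrib_right del: sum_ennreal)
    also have "\<dots> \<le> (\<Sum>k=1..K. ennreal (\<eta> k) * (\<integral>\<^sup>+ \<omega>. ennreal (g k \<omega>) \<partial>P))"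
      unfolding m_def by (intro sum_mono mult_left_mono Min_le) auto
    also have "\<dots> = (\<integral>\<^sup>+ \<omega>. ennreal (\<Sum>k=1..K. \<eta> k * g k \<omega>) \<partial>P)"
      using \<eta>0 g0 by (simp add: sum_ennreal[symmetric] ennreal_mult' nn_integral_sum nn_integral_cmult del: sum_ennreal)
    also have "\<dots> \<le> (\<integral>\<^sup>+ \<omega>. ennreal (A0 + A1 * (\<Sum>k\<le>K. \<eta> k * E k \<omega>)) \<partial>P)"
      by (intro nn_integral_mono ennreal_leI path)
    also have "\<dots> = ennreal A0 + ennreal A1 * (\<Sum>k\<le>K. ennreal (\<eta> k) * (\<integral>\<^sup>+ \<omega>. ennreal (E k \<omega>) \<partial>P))"
      using \<eta>0 E0 A0 A
      by (simp add: sum_ennreal[symmetric] ennreal_plus sum_nonneg ennreal_mult' nn_integral_add nn_integral_sum nn_integral_cmult P.emeasure_space_1 del: sum_ennreal)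
    also have "\<dots> \<le> ennreal A0 + ennreal A1 * (\<Sum>k\<le>K. ennreal (\<eta> k) * ennreal (V / real n))"
      using err(1) by (intro add_left_mono mult_left_mono sum_mono) (auto simp: E_def V_def p_def)
    also have "(\<Sum>k\<le>K. ennreal (\<eta> k) * ennreal (V / real n)) = (\<Sum>k\<le>K. ennreal (\<eta> k * (V / real n)))"
      by (intro sum.cong refl ennreal_mult'[symmetric] \<eta>0)
    also have "\<dots> = ennreal (\<Sum>k\<le>K. \<eta> k * (V / real n))"
      by (rule sum_ennreal) (use \<eta>0 pos in simp)
    also have "\<dots> = ennreal ((\<eta> 0 + \<sigma>) * (V / real n))"
      by (simp only: sum_distrib_right[symmetric] sum_\<eta>)
    also have "ennreal A0 + ennreal A1 * \<dots> = ennreal (A0 + A1 * ((\<eta> 0 + \<sigma>) * (V / real n)))"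
      using \<eta>0[of 0] \<sigma> A0 A pos by (subst ennreal_mult'[symmetric]) (auto simp del: times_divide_eq_right)
    finally have "ennreal \<sigma> * m \<le> ennreal (A0 + A1 * ((\<eta> 0 + \<sigma>) * (V / real n)))" .
    then have "m \<le> ennreal ((A0 + A1 * ((\<eta> 0 + \<sigma>) * (V / real n))) / \<sigma>)"
    proof (cases m)
      case (real y)
      assume *: "ennreal \<sigma> * m \<le> ennreal (A0 + A1 * ((\<eta> 0 + \<sigma>) * (V / real n)))"
      have "0 \<le> A0 + A1 * ((\<eta> 0 + \<sigma>) * (V / real n))"
        using A0 A pos \<eta>0 \<sigma> by simp
      with * real \<sigma> have "\<sigma> * y \<le> A0 + A1 * ((\<eta> 0 + \<sigma>) * (V / real n))"
        by (simp add: ennreal_mult'[symmetric])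
      then show ?thesis
        using real \<sigma> by (auto simp: field_simps intro!: ennreal_leI)
    next
      \<comment> \<open>Excluded by contradiction: \<open>\<sigma>\<close> is positive, so the
        left-hand side would be infinite while the right-hand side is a real number.\<close>
      case top
      assume "ennreal \<sigma> * m \<le> ennreal (A0 + A1 * ((\<eta> 0 + \<sigma>) * (V / real n)))"
      then show ?thesis
        using top \<sigma> by (simp add: ennreal_mult_top top_unique)
    qed
    also have "(A0 + A1 * ((\<eta> 0 + \<sigma>) * (V / real n))) / \<sigma> \<le> C * (1 / \<sigma> + 1 / real n)"
    proof -
      have "(A0 + A1 * ((\<eta> 0 + \<sigma>) * (V / real n))) / \<sigma>
          = A0 / \<sigma> + A1 * V * \<eta> 0 / \<sigma> / real n + A1 * V / real n"
        using \<sigma> n by (simp add: field_simps)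
      also have "A1 * V * \<eta> 0 / \<sigma> / real n \<le> A1 * V * \<eta> 0 / \<sigma> / 1"
        using A pos \<eta>0 \<sigma> n by (intro divide_left_mono) auto
      also have "A0 / \<sigma> + A1 * V * \<eta> 0 / \<sigma> / 1 + A1 * V / real n = (A0 + A1 * V * \<eta> 0) * (1 / \<sigma>) + A1 * V * (1 / real n)"
        by (simp add: add_divide_distrib)
      also have "\<dots> \<le> C * (1 / \<sigma>) + C * (1 / real n)"
        using A A0 pos \<eta>0 \<sigma> n by (intro add_mono mult_right_mono) (auto simp: C_def)
      finally show ?thesis
        by (simp add: distrib_left)
    qed
    finally show ?thesis
      by (simp add: m_def \<sigma>_def g_def ennreal_leI)
  qed
  ultimately show ?thesis
    by blast
qed

end

text \<open>Expectations are extended nonnegative integrals, so the bound cannot hold through the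
  default value 0 of a non-integrable Bochner integral. The constant \<open>C\<close> is chosen
  before the sample size, the probability space, the run and the horizon \<open>K\<close>.\<close>

theorem corollary3p2:
  fixes \<nu> :: "'a measure" and N :: nat and Q :: "(nat \<Rightarrow> 'a) measure"
    and D :: "((nat \<Rightarrow> 'a) \<Rightarrow> real) set"
    and H :: "((nat \<Rightarrow> 'a) \<Rightarrow> real) \<Rightarrow> (nat \<Rightarrow> 'a) \<Rightarrow> real"
    and \<psi> :: "real^'p \<Rightarrow> (nat \<Rightarrow> 'a) \<Rightarrow> real"
    and lam \<mu> C_m C_g :: real and \<eta> :: "nat \<Rightarrow> real"
    and \<theta>init \<Delta>init :: "real^'p"
  assumes "sigma_finite_measure \<nu>"
    and Q_def: "Q = config_space \<nu> N"
    and hamiltonian: "self_adjoint_op Q D H"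
    and psi_dom: "\<And>t. \<psi> t \<in> D"
    and psi_nonzero: "\<And>t. \<not> (AE x in Q. \<psi> t x = 0)"
    and psi_meas: "(\<lambda>(t, x). \<psi> t x) \<in> borel_measurable (borel \<Otimes>\<^sub>M Q)"
    and Hpsi_meas: "(\<lambda>(t, x). H (\<psi> t) x) \<in> borel_measurable (borel \<Otimes>\<^sub>M Q)"
    and log_grad_meas: "(\<lambda>(t, x). log_grad \<psi> t x) \<in> borel_measurable (borel \<Otimes>\<^sub>M Q)"
    and log_psi_diff:
      "\<And>t. AE x in born Q (\<psi> t). (\<lambda>s. ln \<bar>\<psi> s x\<bar>) differentiable (at t)"
    and energy_diff: "\<And>t. energy Q H \<psi> differentiable (at t)"
    and vmc_identity:
      "\<And>t. energy_grad Q H \<psi> t =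
         2 *\<^sub>R (\<integral>x. centered_energy Q H \<psi> t x *\<^sub>R centered_log_grad Q \<psi> t x \<partial>born Q (\<psi> t))"
    and "lam > 0" and "0 \<le> \<mu>" and "\<mu> < 1"
    and "C_m > 0"
    and moment_log_grad:
      "\<And>t. (\<integral>\<^sup>+ x. ennreal (norm (log_grad \<psi> t x) ^ 4) \<partial>born Q (\<psi> t)) \<le> ennreal C_m"
    and moment_energy:
      "\<And>t. (\<integral>\<^sup>+ x. ennreal (local_energy H \<psi> t x ^ 4) \<partial>born Q (\<psi> t)) \<le> ennreal C_m"
    and "C_g > 0"
    and lipschitz_grad:
      "\<And>t t'. norm (energy_grad Q H \<psi> t - energy_grad Q H \<psi> t') \<le> C_g * norm (t - t')"
    and step_decreasing: "\<And>k. k \<ge> 1 \<Longrightarrow> 0 < \<eta> k \<and> \<eta> k \<le> \<eta> (k - 1)"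
    and step_init: "0 < \<eta> 0" "\<eta> 0 \<le> 2 * lam * (1 - \<mu>) / C_g"
  shows "\<exists>C>0. \<forall>n\<ge>2. \<forall>(P :: 'w measure) X \<theta> \<Delta>.
           spring_run Q H \<psi> lam \<mu> \<eta> \<theta>init \<Delta>init n P X \<theta> \<Delta> \<longrightarrow>
           (\<forall>K\<ge>1. (MIN k\<in>{1..K}. \<integral>\<^sup>+ \<omega>. ennreal ((norm (energy_grad Q H \<psi> (\<theta> k \<omega>)))\<^sup>2) \<partial>P)
                    \<le> ennreal (C * (1 / (\<Sum>k=1..K. \<eta> k) + 1 / real n)))"
proof -
  have sf: "sigma_finite_measure Q"
    unfolding Q_def by (rule sigma_finite_config_space) fact
  \<comment> \<open>The domain of a self-adjoint operator consists of square-integrable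
    functions.\<close>
  have sq: "\<psi> t \<in> square_integrable Q" for t
    using hamiltonian psi_dom unfolding self_adjoint_op_def densely_defined_linear_def by blast
  interpret vmc Q H \<psi> C_m C_g
    by (rule vmc.intro; fact)
  show ?thesis
  proof (rule spring_convergence[OF \<open>lam > 0\<close> \<open>0 \<le> \<mu>\<close> \<open>\<mu> < 1\<close>])
    show "0 < \<eta> k" for k
      using step_init(1) step_decreasing[of k] by (cases "k = 0") auto
    show "\<eta> (Suc k) \<le> \<eta> k" for k
      using step_decreasing[of "Suc k"] by simp
  qed (rule step_init(2))
qed

end
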